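(* Let $A$ be a maximal abelian subgroup of a CSA$^\ast$-group $G$, let $B$ be a subgroup of $G$ and $\phi:A\to B$ an isomorphism. Suppose that there exists $s\in G$ such that $B=A^s$ and $\phi(a)=a^s$ for all $a\in A$. Then the HNN-extension $G^\ast=\langle G,t\mid t^{-1}at=\phi(a),\ a\in A\rangle$ is a CSA$^\ast$-group.
   Context: Notation: $a^s=s^{-1}as$ and $A^s=s^{-1}As$. A subgroup $H$ of a group $G$ is malnormal if $H\cap H^x=1$ for all $x\in G\setminus H$. A group is a CSA-group if all its maximal abelian subgroups are malnormal. A CSA$^\ast$-group is a CSA-group without elements of order 2. *)

theory Defs
  imports "HOL-Algebra.Multiplicative_Group"
begin

section \<open>CSA groups\<close>

text \<open>Right conjugation, x^s = s^{-1} x s, of elements and of subsets.\<close>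

definition conj_elt :: "('a, 'm) monoid_scheme \<Rightarrow> 'a \<Rightarrow> 'a \<Rightarrow> 'a"
  where "conj_elt G x s = inv\<^bsub>G\<^esub> s \<otimes>\<^bsub>G\<^esub> x \<otimes>\<^bsub>G\<^esub> s"

definition conj_set :: "('a, 'm) monoid_scheme \<Rightarrow> 'a set \<Rightarrow> 'a \<Rightarrow> 'a set"
  where "conj_set G H s = (\<lambda>x. conj_elt G x s) ` H"

definition malnormal :: "'a set \<Rightarrow> ('a, 'm) monoid_scheme \<Rightarrow> bool"
  where "malnormal H G \<longleftrightarrow>
    subgroup H G \<and> (\<forall>x \<in> carrier G - H. H \<inter> conj_set G H x = {\<one>\<^bsub>G\<^esub>})"

definition abelian_subgroup :: "'a set \<Rightarrow> ('a, 'm) monoid_scheme \<Rightarrow> bool"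
  where "abelian_subgroup H G \<longleftrightarrow> subgroup H G \<and> comm_group (G\<lparr>carrier := H\<rparr>)"

definition maximal_abelian_subgroup :: "'a set \<Rightarrow> ('a, 'm) monoid_scheme \<Rightarrow> bool"
  where "maximal_abelian_subgroup H G \<longleftrightarrow>
    abelian_subgroup H G \<and> (\<forall>K. abelian_subgroup K G \<and> H \<subseteq> K \<longrightarrow> K = H)"

definition CSA_group :: "('a, 'm) monoid_scheme \<Rightarrow> bool"
  where "CSA_group G \<longleftrightarrow>
    group G \<and> (\<forall>H. maximal_abelian_subgroup H G \<longrightarrow> malnormal H G)"

definition CSA_star_group :: "('a, 'm) monoid_scheme \<Rightarrow> bool"
  where "CSA_star_group G \<longleftrightarrow> CSA_group G \<and> (\<forall>x \<in> carrier G. group.ord G x \<noteq> 2)"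


section \<open>HNN extensions\<close>

text \<open>
  The group with presentation < G, t | t^{-1} a t = f(a), a in A > is realised as the set of words
  in the elements of G, the stable letter t and its formal inverse, modulo the congruence
  generated by the multiplication table of G, the cancellation of t against its inverse, and the
  defining relations.
\<close>

datatype 'a hnn_letter = Base 'a | Stable | Stable_inv

definition hnn_words :: "('a, 'm) monoid_scheme \<Rightarrow> 'a hnn_letter list set"
  where "hnn_words G = lists (Base ` carrier G \<union> {Stable, Stable_inv})"

inductive hnn_eq ::
  "('a, 'm) monoid_scheme \<Rightarrow> 'a set \<Rightarrow> ('a \<Rightarrow> 'a) \<Rightarrow> 'a hnn_letter list \<Rightarrow> 'a hnn_letter list \<Rightarrow> bool"
  for G A f where
  refl: "w \<in> hnn_words G \<Longrightarrow> hnn_eq G A f w w"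
| sym: "hnn_eq G A f v w \<Longrightarrow> hnn_eq G A f w v"
| trans: "hnn_eq G A f u v \<Longrightarrow> hnn_eq G A f v w \<Longrightarrow> hnn_eq G A f u w"
| append: "hnn_eq G A f v v' \<Longrightarrow> hnn_eq G A f w w' \<Longrightarrow> hnn_eq G A f (v @ w) (v' @ w')"
| base_one: "hnn_eq G A f [Base \<one>\<^bsub>G\<^esub>] []"
| base_mult: "g \<in> carrier G \<Longrightarrow> h \<in> carrier G \<Longrightarrow>
    hnn_eq G A f [Base g, Base h] [Base (g \<otimes>\<^bsub>G\<^esub> h)]"
| stable_right_inv: "hnn_eq G A f [Stable, Stable_inv] []"
| stable_left_inv: "hnn_eq G A f [Stable_inv, Stable] []"
| stable_conj: "a \<in> A \<Longrightarrow> hnn_eq G A f [Stable_inv, Base a, Stable] [Base (f a)]"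

definition hnn_class ::
  "('a, 'm) monoid_scheme \<Rightarrow> 'a set \<Rightarrow> ('a \<Rightarrow> 'a) \<Rightarrow> 'a hnn_letter list \<Rightarrow> 'a hnn_letter list set"
  where "hnn_class G A f w = {v. hnn_eq G A f w v}"

definition HNN_extension ::
  "('a, 'm) monoid_scheme \<Rightarrow> 'a set \<Rightarrow> ('a \<Rightarrow> 'a) \<Rightarrow> 'a hnn_letter list set monoid"
  where "HNN_extension G A f =
    \<lparr>carrier = hnn_class G A f ` hnn_words G,
     mult = (\<lambda>X Y. \<Union>v \<in> X. \<Union>w \<in> Y. hnn_class G A f (v @ w)),
     one = hnn_class G A f []\<rparr>"

text \<open>
  The construction does give a group, and this group has the universal property of the
  presentation.
\<close>

lemma hnn_words_simps [simp]:
  "[] \<in> hnn_words G"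
  "Base g # w \<in> hnn_words G \<longleftrightarrow> g \<in> carrier G \<and> w \<in> hnn_words G"
  "Stable # w \<in> hnn_words G \<longleftrightarrow> w \<in> hnn_words G"
  "Stable_inv # w \<in> hnn_words G \<longleftrightarrow> w \<in> hnn_words G"
  "v @ w \<in> hnn_words G \<longleftrightarrow> v \<in> hnn_words G \<and> w \<in> hnn_words G"
  by (auto simp: hnn_words_def)

lemma hnn_words_ConsD:
  assumes "l # w \<in> hnn_words G"
  shows "[l] \<in> hnn_words G" "w \<in> hnn_words G"
  using assms by (auto simp: hnn_words_def)

lemma hnn_class_eq_iff:
  assumes "w \<in> hnn_words G"
  shows "hnn_class G A f v = hnn_class G A f w \<longleftrightarrow> hnn_eq G A f v w"
proof
  assume "hnn_class G A f v = hnn_class G A f w"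
  moreover have "w \<in> hnn_class G A f w"
    using assms by (simp add: hnn_class_def hnn_eq.refl)
  ultimately have "w \<in> hnn_class G A f v" by simp
  then show "hnn_eq G A f v w" by (simp add: hnn_class_def)
next
  assume "hnn_eq G A f v w"
  then show "hnn_class G A f v = hnn_class G A f w"
    unfolding hnn_class_def by (blast intro: hnn_eq.sym hnn_eq.trans)
qed

lemma HNN_extension_mult:
  assumes "v \<in> hnn_words G" "w \<in> hnn_words G"
  shows "hnn_class G A f v \<otimes>\<^bsub>HNN_extension G A f\<^esub> hnn_class G A f w = hnn_class G A f (v @ w)"
proof -
  have "hnn_class G A f (v' @ w') = hnn_class G A f (v @ w)"
    if "v' \<in> hnn_class G A f v" "w' \<in> hnn_class G A f w" for v' w'
  proof -
    have "hnn_eq G A f v v'" "hnn_eq G A f w w'"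
      using that by (simp_all add: hnn_class_def)
    then have "hnn_eq G A f (v' @ w') (v @ w)"
      by (intro hnn_eq.append hnn_eq.sym[of G A f v] hnn_eq.sym[of G A f w])
    then show ?thesis
      using assms by (simp add: hnn_class_eq_iff)
  qed
  moreover have "v \<in> hnn_class G A f v" "w \<in> hnn_class G A f w"
    using assms by (simp_all add: hnn_class_def hnn_eq.refl)
  ultimately have "(\<Union>v' \<in> hnn_class G A f v. \<Union>w' \<in> hnn_class G A f w. hnn_class G A f (v' @ w'))
      = hnn_class G A f (v @ w)"
    by (intro equalityI UN_least) blast+
  then show ?thesis
    by (simp add: HNN_extension_def)
qed

lemma hnn_word_inverse:
  fixes G (structure)
  assumes "group G" "w \<in> hnn_words G"
  shows "\<exists>v \<in> hnn_words G. hnn_eq G A f (v @ w) []"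
  using assms(2)
proof (induction w)
  case Nil
  then show ?case by (metis append_Nil hnn_eq.refl hnn_words_simps(1))
next
  case (Cons x w)
  interpret group G by fact
  have x: "[x] \<in> hnn_words G" and w: "w \<in> hnn_words G"
    using hnn_words_ConsD[OF Cons.prems] by simp_all
  obtain v where v: "v \<in> hnn_words G" "hnn_eq G A f (v @ w) []"
    using Cons.IH w by blast
  obtain y where y: "y \<in> hnn_words G" "hnn_eq G A f (y @ [x]) []"
  proof (cases x)
    case (Base g)
    then have g: "g \<in> carrier G" using x by simp
    have "hnn_eq G A f [Base (inv g), Base g] [Base (inv g \<otimes> g)]"
      using g by (intro hnn_eq.base_mult) auto
    then have "hnn_eq G A f ([Base (inv g)] @ [x]) []"
      using g Base hnn_eq.base_one[of G A f] by (auto intro: hnn_eq.trans)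
    then show thesis using g that[of "[Base (inv g)]"] by simp
  next
    case Stable
    then show thesis
      by (intro that[of "[Stable_inv]"]) (simp_all add: hnn_eq.stable_left_inv)
  next
    case Stable_inv
    then show thesis
      by (intro that[of "[Stable]"]) (simp_all add: hnn_eq.stable_right_inv)
  qed
  have "hnn_eq G A f (v @ ((y @ [x]) @ w)) (v @ ([] @ w))"
    by (intro hnn_eq.append hnn_eq.refl y(2) v(1) w)
  then have "hnn_eq G A f ((v @ y) @ (x # w)) []"
    using v(2) by (auto intro: hnn_eq.trans)
  then show ?case using v(1) y(1) by (intro bexI[of _ "v @ y"]) auto
qed

lemma HNN_extension_group:
  assumes "group G"
  shows "group (HNN_extension G A f)"
proof (rule groupI)
  let ?H = "HNN_extension G A f" and ?c = "hnn_class G A f"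
  have car: "carrier ?H = ?c ` hnn_words G" and one: "\<one>\<^bsub>?H\<^esub> = ?c []"
    by (simp_all add: HNN_extension_def)
  show "X \<otimes>\<^bsub>?H\<^esub> Y \<in> carrier ?H" if "X \<in> carrier ?H" "Y \<in> carrier ?H" for X Y
    using that by (auto simp: car HNN_extension_mult)
  show "\<one>\<^bsub>?H\<^esub> \<in> carrier ?H"
    by (auto simp: car one)
  show "(X \<otimes>\<^bsub>?H\<^esub> Y) \<otimes>\<^bsub>?H\<^esub> Z = X \<otimes>\<^bsub>?H\<^esub> (Y \<otimes>\<^bsub>?H\<^esub> Z)"
    if "X \<in> carrier ?H" "Y \<in> carrier ?H" "Z \<in> carrier ?H" for X Y Z
    using that by (auto simp: car HNN_extension_mult)
  show "\<one>\<^bsub>?H\<^esub> \<otimes>\<^bsub>?H\<^esub> X = X" if "X \<in> carrier ?H" for X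
    using that by (auto simp: car one HNN_extension_mult)
  show "\<exists>Y \<in> carrier ?H. Y \<otimes>\<^bsub>?H\<^esub> X = \<one>\<^bsub>?H\<^esub>" if X: "X \<in> carrier ?H" for X
  proof -
    obtain w where w: "w \<in> hnn_words G" "X = ?c w"
      using X by (auto simp: car)
    obtain v where v: "v \<in> hnn_words G" "hnn_eq G A f (v @ w) []"
      using hnn_word_inverse[OF assms w(1)] by blast
    then have "?c v \<otimes>\<^bsub>?H\<^esub> X = \<one>\<^bsub>?H\<^esub>"
      using w by (simp add: one HNN_extension_mult hnn_class_eq_iff)
    then show ?thesis using v(1) by (auto simp: car)
  qed
qed

primrec hnn_letter_eval :: "('b, 'n) monoid_scheme \<Rightarrow> ('a \<Rightarrow> 'b) \<Rightarrow> 'b \<Rightarrow> 'a hnn_letter \<Rightarrow> 'b"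
  where
    "hnn_letter_eval K p x (Base g) = p g"
  | "hnn_letter_eval K p x Stable = x"
  | "hnn_letter_eval K p x Stable_inv = inv\<^bsub>K\<^esub> x"

primrec hnn_eval :: "('b, 'n) monoid_scheme \<Rightarrow> ('a \<Rightarrow> 'b) \<Rightarrow> 'b \<Rightarrow> 'a hnn_letter list \<Rightarrow> 'b"
  where
    "hnn_eval K p x [] = \<one>\<^bsub>K\<^esub>"
  | "hnn_eval K p x (l # w) = hnn_letter_eval K p x l \<otimes>\<^bsub>K\<^esub> hnn_eval K p x w"

lemma HNN_extension_base_hom:
  "(\<lambda>g. hnn_class G A f [Base g]) \<in> hom G (HNN_extension G A f)"
proof (rule homI)
  fix g h assume g: "g \<in> carrier G" and h: "h \<in> carrier G"
  show "hnn_class G A f [Base g] \<in> carrier (HNN_extension G A f)"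
    using g by (simp add: HNN_extension_def)
  have gh: "hnn_eq G A f [Base g, Base h] [Base (g \<otimes>\<^bsub>G\<^esub> h)]"
    using g h by (rule hnn_eq.base_mult)
  have "hnn_class G A f [Base (g \<otimes>\<^bsub>G\<^esub> h)] = hnn_class G A f [Base g, Base h]"
    using g h by (subst hnn_class_eq_iff) (simp_all add: hnn_eq.sym[OF gh])
  then show "hnn_class G A f [Base (g \<otimes>\<^bsub>G\<^esub> h)] =
    hnn_class G A f [Base g] \<otimes>\<^bsub>HNN_extension G A f\<^esub> hnn_class G A f [Base h]"
    using g h by (simp add: HNN_extension_mult)
qed

lemma HNN_extension_stable_closed:
  "hnn_class G A f [Stable] \<in> carrier (HNN_extension G A f)"
  by (simp add: HNN_extension_def)

lemma HNN_extension_inv_stable: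
  assumes "group G"
  shows "inv\<^bsub>HNN_extension G A f\<^esub> (hnn_class G A f [Stable]) = hnn_class G A f [Stable_inv]"
proof -
  interpret H: group "HNN_extension G A f"
    using assms by (rule HNN_extension_group)
  have "hnn_class G A f [Stable_inv, Stable] = hnn_class G A f []"
    by (subst hnn_class_eq_iff) (simp_all add: hnn_eq.stable_left_inv)
  then have "hnn_class G A f [Stable_inv] \<otimes>\<^bsub>HNN_extension G A f\<^esub> hnn_class G A f [Stable]
      = \<one>\<^bsub>HNN_extension G A f\<^esub>"
    by (subst HNN_extension_mult) (simp_all, simp add: HNN_extension_def)
  then show ?thesis
    by (rule H.inv_equality) (simp_all add: HNN_extension_def)
qed

lemma HNN_extension_stable_conj:
  assumes "group G" "A \<subseteq> carrier G" "f ` A \<subseteq> carrier G" "a \<in> A"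
  shows "conj_elt (HNN_extension G A f) (hnn_class G A f [Base a]) (hnn_class G A f [Stable])
    = hnn_class G A f [Base (f a)]"
proof -
  have a: "a \<in> carrier G" "f a \<in> carrier G" using assms(2-4) by auto
  have "hnn_class G A f [Stable_inv, Base a, Stable] = hnn_class G A f [Base (f a)]"
    using a assms(4) by (subst hnn_class_eq_iff) (simp_all add: hnn_eq.stable_conj)
  then show ?thesis
    using a by (simp add: conj_elt_def HNN_extension_inv_stable[OF assms(1)] HNN_extension_mult)
qed

lemma HNN_extension_universal:
  fixes G (structure)
  assumes "group G" "A \<subseteq> carrier G" "f ` A \<subseteq> carrier G"
    and "group K" "p \<in> hom G K" "x \<in> carrier K"
    and rel: "\<And>a. a \<in> A \<Longrightarrow> conj_elt K (p a) x = p (f a)"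
  shows "\<exists>h \<in> hom (HNN_extension G A f) K.
    (\<forall>g \<in> carrier G. h (hnn_class G A f [Base g]) = p g) \<and> h (hnn_class G A f [Stable]) = x"
proof -
  interpret G: group G by fact
  interpret K: group K by fact
  interpret p: group_hom G K p by unfold_locales fact
  let ?e = "hnn_eval K p x"
  have p_in: "p g \<in> carrier K" if "g \<in> carrier G" for g using that by simp
  have l_in: "hnn_letter_eval K p x l \<in> carrier K" if "[l] \<in> hnn_words G" for l
    using that assms(6) by (cases l) auto
  have e_in: "?e w \<in> carrier K" if "w \<in> hnn_words G" for w
    using that
  proof (induction w)
    case (Cons l w)
    then show ?case using l_in hnn_words_ConsD[OF Cons.prems] by simp
  qed simp
  have e_app: "?e (v @ w) = ?e v \<otimes>\<^bsub>K\<^esub> ?e w" if "v \<in> hnn_words G" "w \<in> hnn_words G" for v w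
    using that
  proof (induction v)
    case (Cons l v)
    then show ?case
      using l_in e_in hnn_words_ConsD[OF Cons.prems(1)] by (simp add: K.m_assoc)
  qed (simp add: e_in)
  have inv: "v \<in> hnn_words G \<and> w \<in> hnn_words G \<and> ?e v = ?e w" if "hnn_eq G A f v w" for v w
    using that
  proof induction
    case (append v v' w w')
    then show ?case by (simp add: e_app)
  next
    case (stable_conj a)
    then have "a \<in> carrier G" "f a \<in> carrier G" using assms(2,3) by auto
    then show ?case using rel[OF stable_conj] assms(6) by (simp add: conj_elt_def K.m_assoc)
  qed (use assms(6) in auto)
  define h where "h X = ?e (SOME w. w \<in> X)" for X
  have h: "h (hnn_class G A f w) = ?e w" if "w \<in> hnn_words G" for w
  proof -
    have "w \<in> hnn_class G A f w" using that by (simp add: hnn_class_def hnn_eq.refl)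
    then have "(SOME v. v \<in> hnn_class G A f w) \<in> hnn_class G A f w" by (rule someI)
    then show ?thesis using inv unfolding h_def by (simp add: hnn_class_def)
  qed
  have "h \<in> hom (HNN_extension G A f) K"
  proof (rule homI)
    fix X assume "X \<in> carrier (HNN_extension G A f)"
    then show "h X \<in> carrier K" by (auto simp: HNN_extension_def h e_in)
  next
    fix X Y
    assume "X \<in> carrier (HNN_extension G A f)" "Y \<in> carrier (HNN_extension G A f)"
    then obtain v w where "v \<in> hnn_words G" "X = hnn_class G A f v"
      "w \<in> hnn_words G" "Y = hnn_class G A f w"
      by (auto simp: HNN_extension_def)
    then show "h (X \<otimes>\<^bsub>HNN_extension G A f\<^esub> Y) = h X \<otimes>\<^bsub>K\<^esub> h Y"
      by (simp add: HNN_extension_mult h e_app)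
  qed
  then show ?thesis using assms(6) by (intro bexI[of _ h]) (auto simp: h)
qed

lemma HNN_extension_hom_unique:
  fixes G (structure)
  assumes "group G" "A \<subseteq> carrier G" "f ` A \<subseteq> carrier G" and "group K"
    and h: "h \<in> hom (HNN_extension G A f) K" and k: "k \<in> hom (HNN_extension G A f) K"
    and base: "\<And>g. g \<in> carrier G \<Longrightarrow> h (hnn_class G A f [Base g]) = k (hnn_class G A f [Base g])"
    and stable: "h (hnn_class G A f [Stable]) = k (hnn_class G A f [Stable])"
    and X: "X \<in> carrier (HNN_extension G A f)"
  shows "h X = k X"
proof -
  let ?H = "HNN_extension G A f" and ?c = "hnn_class G A f"
  interpret H: group ?H using assms(1) by (rule HNN_extension_group)
  interpret K: group K by fact
  interpret h: group_hom ?H K h by unfold_locales fact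
  interpret k: group_hom ?H K k by unfold_locales fact
  have car: "?c w \<in> carrier ?H" if "w \<in> hnn_words G" for w
    using that by (simp add: HNN_extension_def)
  note inv_stable = HNN_extension_inv_stable[OF assms(1), of A f]
  have stable_inv: "h (?c [Stable_inv]) = k (?c [Stable_inv])"
    using stable h.hom_inv[of "?c [Stable]"] k.hom_inv[of "?c [Stable]"] car[of "[Stable]"]
    by (simp add: inv_stable)
  have "h (?c w) = k (?c w)" if "w \<in> hnn_words G" for w
    using that
  proof (induction w)
    case Nil
    have "?c [] = \<one>\<^bsub>?H\<^esub>" by (simp add: HNN_extension_def)
    then show ?case by simp
  next
    case (Cons l w)
    have l: "[l] \<in> hnn_words G" and w: "w \<in> hnn_words G"
      using hnn_words_ConsD[OF Cons.prems] by simp_all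
    have "h (?c [l]) = k (?c [l])"
      using l base stable stable_inv by (cases l) auto
    moreover have "?c (l # w) = ?c [l] \<otimes>\<^bsub>?H\<^esub> ?c w"
      using l w by (simp add: HNN_extension_mult)
    ultimately show ?case using Cons.IH w l car by simp
  qed
  then show ?thesis using X by (auto simp: HNN_extension_def)
qed

end

theory Submission
  imports Defs "HOL-Library.Stream" "HOL-Algebra.Bij" "HOL-Algebra.Generated_Groups"
    "HOL-Algebra.Left_Coset"
begin

text \<open>
  Put \<open>u = t s\<inverse>\<close>. Since \<open>\<phi>\<close> is conjugation by \<open>s\<close>, the relations \<open>t\<inverse> a t = s\<inverse> a s\<close> say exactly that \<open>u\<close>
  commutes with every element of \<open>A\<close>; so \<open>G\<^sup>*\<close> arises from \<open>G\<close> by freely adjoining one element to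
  the centralizer of \<open>A\<close>. The conjugates \<open>r u r\<inverse>\<close> with \<open>r \<in> G\<close> depend only on the left coset \<open>r A\<close>.
  They freely generate a normal subgroup \<open>F\<close>, and \<open>G\<^sup>*\<close> is the semidirect product of \<open>F\<close> and \<open>G\<close>,
  where \<open>G\<close> permutes the free generators in the way it permutes the cosets of \<open>A\<close>. Hence \<open>G\<^sup>*\<close> acts
  on the Cayley tree of \<open>F\<close>, a vertex of which is a reduced word, and on the ends of this tree,
  which are the infinite reduced words. The proof reads off the CSA property from the action on
  the ends.

  A group is CSA iff each \<open>h \<noteq> 1\<close> has an abelian centralizer and satisfies
  \<open>[h, h\<^sup>g] = 1 \<Longrightarrow> [h, g] = 1\<close> (lemma \<open>CSA_group_iff_tame\<close>). The maximal abelian subgroup \<open>A\<close> of a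
  CSA group is malnormal, and for the action on cosets this means that a nontrivial element of \<open>G\<close>
  fixes at most one coset. There are three consequences.

   \<^item> The stabilizer of every end is abelian (\<open>stabilizer_abelian\<close>). A commutator in it fixes the end
     and does not translate along it, so it is conjugate to some \<open>c \<in> G\<close> that fixes all letters of a
     tail of the end. If \<open>c \<noteq> 1\<close>, these letters are all equal; up to conjugation they
     are all \<open>u\<close> or all \<open>u\<inverse>\<close>, and the stabilizer of such an end is generated by \<open>A\<close> and \<open>u\<close>.

   \<^item> An element that is not conjugate into \<open>G\<close> is conjugate to a cyclically reduced one and
     translates along an axis, so it fixes exactly two ends (\<open>hyperbolic_fixed_ends\<close>). A
     nontrivial element of \<open>G\<close> that fixes a coset \<open>r A\<close> fixes exactly the two constant ends with letters
     \<open>r u r\<inverse>\<close> or \<open>r u\<inverse> r\<inverse>\<close> (\<open>elliptic_fixed_ends\<close>).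

   \<^item> No element interchanges two ends (\<open>no_swap\<close>); this uses that \<open>G\<close> has no involutions.

  Let \<open>h\<close> fix exactly the ends \<open>\<xi>\<close> and \<open>\<eta>\<close>. An element commuting with \<open>h\<close> permutes them, hence fixes
  both, so the centralizer of \<open>h\<close> lies in the abelian stabilizer of \<open>\<xi>\<close>. If \<open>h\<^sup>g\<close> commutes with \<open>h\<close>, then
  \<open>h\<^sup>g\<close> also fixes \<open>\<xi>\<close> and \<open>\<eta>\<close>; therefore \<open>g\<close> permutes \<open>\<xi>\<close> and \<open>\<eta>\<close>, fixes them, and commutes with \<open>h\<close>
  (\<open>two_fixed_ends_imp_tame\<close>). Up to conjugation there remain the elements of \<open>G\<close> that fix no
  coset. They fix only the base vertex of the tree, so everything happens inside \<open>G\<close>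
  (\<open>fixed_point_free_imp_tame\<close>).
\<close>

section \<open>CSA groups through commuting elements\<close>

text \<open>
  The two clauses are commutative transitivity at \<open>h\<close> and the conjugation property at \<open>h\<close>. Unlike
  malnormality of maximal abelian subgroups they concern single elements, and they are invariant
  under conjugation of \<open>h\<close>.
\<close>

definition tame :: "('a, 'm) monoid_scheme \<Rightarrow> 'a \<Rightarrow> bool" where
  "tame G h \<longleftrightarrow>
    (\<forall>x \<in> carrier G. \<forall>y \<in> carrier G. h \<otimes>\<^bsub>G\<^esub> x = x \<otimes>\<^bsub>G\<^esub> h \<longrightarrow> h \<otimes>\<^bsub>G\<^esub> y = y \<otimes>\<^bsub>G\<^esub> h \<longrightarrow>
      x \<otimes>\<^bsub>G\<^esub> y = y \<otimes>\<^bsub>G\<^esub> x) \<and>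
    (\<forall>g \<in> carrier G. h \<otimes>\<^bsub>G\<^esub> conj_elt G h g = conj_elt G h g \<otimes>\<^bsub>G\<^esub> h \<longrightarrow> h \<otimes>\<^bsub>G\<^esub> g = g \<otimes>\<^bsub>G\<^esub> h)"

lemma tameI:
  assumes "\<And>x y. \<lbrakk>x \<in> carrier G; y \<in> carrier G; h \<otimes>\<^bsub>G\<^esub> x = x \<otimes>\<^bsub>G\<^esub> h; h \<otimes>\<^bsub>G\<^esub> y = y \<otimes>\<^bsub>G\<^esub> h\<rbrakk>
      \<Longrightarrow> x \<otimes>\<^bsub>G\<^esub> y = y \<otimes>\<^bsub>G\<^esub> x"
    and "\<And>g. \<lbrakk>g \<in> carrier G; h \<otimes>\<^bsub>G\<^esub> conj_elt G h g = conj_elt G h g \<otimes>\<^bsub>G\<^esub> h\<rbrakk>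
      \<Longrightarrow> h \<otimes>\<^bsub>G\<^esub> g = g \<otimes>\<^bsub>G\<^esub> h"
  shows "tame G h"
  using assms unfolding tame_def by blast

lemma tame_commute:
  assumes "tame G h" "x \<in> carrier G" "y \<in> carrier G"
    "h \<otimes>\<^bsub>G\<^esub> x = x \<otimes>\<^bsub>G\<^esub> h" "h \<otimes>\<^bsub>G\<^esub> y = y \<otimes>\<^bsub>G\<^esub> h"
  shows "x \<otimes>\<^bsub>G\<^esub> y = y \<otimes>\<^bsub>G\<^esub> x"
  using assms unfolding tame_def by blast

lemma tame_conj_elt:
  assumes "tame G h" "g \<in> carrier G"
    "h \<otimes>\<^bsub>G\<^esub> conj_elt G h g = conj_elt G h g \<otimes>\<^bsub>G\<^esub> h"
  shows "h \<otimes>\<^bsub>G\<^esub> g = g \<otimes>\<^bsub>G\<^esub> h"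
  using assms unfolding tame_def by blast

context group
begin

lemma inv_cancel_left [simp]:
  "x \<in> carrier G \<Longrightarrow> y \<in> carrier G \<Longrightarrow> inv x \<otimes> (x \<otimes> y) = y"
  "x \<in> carrier G \<Longrightarrow> y \<in> carrier G \<Longrightarrow> x \<otimes> (inv x \<otimes> y) = y"
  by (simp_all add: m_assoc [symmetric])

lemma conj_elt_closed [simp]:
  "x \<in> carrier G \<Longrightarrow> g \<in> carrier G \<Longrightarrow> conj_elt G x g \<in> carrier G"
  by (simp add: conj_elt_def)

lemma conj_elt_mult:
  "\<lbrakk>x \<in> carrier G; y \<in> carrier G; g \<in> carrier G\<rbrakk> \<Longrightarrow>
    conj_elt G (x \<otimes> y) g = conj_elt G x g \<otimes> conj_elt G y g"
  by (simp add: conj_elt_def m_assoc)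

lemma conj_elt_one_left [simp]: "g \<in> carrier G \<Longrightarrow> conj_elt G \<one> g = \<one>"
  by (simp add: conj_elt_def)

lemma conj_elt_conj_elt:
  "\<lbrakk>x \<in> carrier G; g \<in> carrier G; h \<in> carrier G\<rbrakk> \<Longrightarrow>
    conj_elt G (conj_elt G x g) h = conj_elt G x (g \<otimes> h)"
  by (simp add: conj_elt_def m_assoc inv_mult_group)

lemma conj_elt_inj:
  assumes "x \<in> carrier G" "y \<in> carrier G" "g \<in> carrier G"
  shows "conj_elt G x g = conj_elt G y g \<longleftrightarrow> x = y"
  using assms by (simp add: conj_elt_def)

lemma conj_elt_eq_one_iff [simp]:
  "\<lbrakk>x \<in> carrier G; g \<in> carrier G\<rbrakk> \<Longrightarrow> conj_elt G x g = \<one> \<longleftrightarrow> x = \<one>"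
  using conj_elt_inj[of x \<one> g] by simp

lemma conj_elt_eq_self_iff:
  assumes "x \<in> carrier G" "g \<in> carrier G"
  shows "conj_elt G x g = x \<longleftrightarrow> x \<otimes> g = g \<otimes> x"
proof
  assume "conj_elt G x g = x"
  then have "g \<otimes> conj_elt G x g = g \<otimes> x" by simp
  then show "x \<otimes> g = g \<otimes> x" using assms by (simp add: conj_elt_def m_assoc)
next
  assume "x \<otimes> g = g \<otimes> x"
  then show "conj_elt G x g = x" using assms by (simp add: conj_elt_def m_assoc)
qed

lemma commute_conj_elt_iff:
  assumes "x \<in> carrier G" "y \<in> carrier G" "g \<in> carrier G"
  shows "conj_elt G x g \<otimes> conj_elt G y g = conj_elt G y g \<otimes> conj_elt G x g \<longleftrightarrow> x \<otimes> y = y \<otimes> x"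
  using assms by (simp add: conj_elt_mult [symmetric] conj_elt_inj)

lemma commute_inv:
  assumes "x \<in> carrier G" "y \<in> carrier G" "x \<otimes> y = y \<otimes> x"
  shows "x \<otimes> inv y = inv y \<otimes> x"
proof -
  have "inv y \<otimes> (x \<otimes> y) \<otimes> inv y = inv y \<otimes> (y \<otimes> x) \<otimes> inv y" using assms(3) by simp
  then show ?thesis using assms(1,2) by (simp add: m_assoc)
qed

lemma commute_mult:
  assumes "x \<in> carrier G" "y \<in> carrier G" "z \<in> carrier G" "x \<otimes> y = y \<otimes> x" "x \<otimes> z = z \<otimes> x"
  shows "x \<otimes> (y \<otimes> z) = (y \<otimes> z) \<otimes> x"
  using assms by (metis m_assoc)

lemma tame_conj:
  assumes h: "h \<in> carrier G" and k: "k \<in> carrier G" and tame: "tame G (conj_elt G h k)"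
  shows "tame G h"
proof (rule tameI)
  fix x y
  assume x: "x \<in> carrier G" "h \<otimes> x = x \<otimes> h" and y: "y \<in> carrier G" "h \<otimes> y = y \<otimes> h"
  have "conj_elt G x k \<otimes> conj_elt G y k = conj_elt G y k \<otimes> conj_elt G x k"
    by (rule tame_commute[OF tame conj_elt_closed[OF x(1) k] conj_elt_closed[OF y(1) k]
      commute_conj_elt_iff[OF h x(1) k, THEN iffD2, OF x(2)]
      commute_conj_elt_iff[OF h y(1) k, THEN iffD2, OF y(2)]])
  then show "x \<otimes> y = y \<otimes> x" by (simp only: commute_conj_elt_iff[OF x(1) y(1) k])
next
  fix g
  assume g: "g \<in> carrier G" and comm: "h \<otimes> conj_elt G h g = conj_elt G h g \<otimes> h"
  have eq: "conj_elt G (conj_elt G h k) (conj_elt G g k) = conj_elt G (conj_elt G h g) k"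
    using g h k by (simp add: conj_elt_def m_assoc inv_mult_group)
  have "conj_elt G h k \<otimes> conj_elt G g k = conj_elt G g k \<otimes> conj_elt G h k"
    by (rule tame_conj_elt[OF tame conj_elt_closed[OF g k]])
      (simp only: eq commute_conj_elt_iff[OF h conj_elt_closed[OF h g] k] comm)
  then show "h \<otimes> g = g \<otimes> h" by (simp only: commute_conj_elt_iff[OF h g k])
qed

lemma abelian_subgroup_iff:
  "abelian_subgroup H G \<longleftrightarrow> subgroup H G \<and> (\<forall>x \<in> H. \<forall>y \<in> H. x \<otimes> y = y \<otimes> x)"
proof -
  have "comm_group (G\<lparr>carrier := H\<rparr>) \<longleftrightarrow> (\<forall>x \<in> H. \<forall>y \<in> H. x \<otimes> y = y \<otimes> x)" if H: "subgroup H G"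
  proof
    assume "comm_group (G\<lparr>carrier := H\<rparr>)"
    then interpret c: comm_group "G\<lparr>carrier := H\<rparr>" .
    show "\<forall>x \<in> H. \<forall>y \<in> H. x \<otimes> y = y \<otimes> x" using c.m_comm by simp
  next
    assume *: "\<forall>x \<in> H. \<forall>y \<in> H. x \<otimes> y = y \<otimes> x"
    interpret h: group "G\<lparr>carrier := H\<rparr>" using H by (rule subgroup_imp_group)
    show "comm_group (G\<lparr>carrier := H\<rparr>)" by unfold_locales (use * in simp)
  qed
  then show ?thesis unfolding abelian_subgroup_def by blast
qed

lemma abelian_subgroup_centralizer:
  assumes "tame G z" "z \<in> carrier G"
  shows "abelian_subgroup {x \<in> carrier G. z \<otimes> x = x \<otimes> z} G"
proof -
  have "subgroup {x \<in> carrier G. z \<otimes> x = x \<otimes> z} G"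
    using assms(2) by (intro subgroupI) (auto simp: commute_mult commute_inv)
  then show ?thesis
    using assms tame_commute[OF assms(1)] by (auto simp: abelian_subgroup_iff)
qed

text \<open>
  The union of a chain of abelian subgroups is an abelian subgroup, so Zorn's lemma applies.
\<close>

lemma maximal_abelian_subgroup_exists:
  assumes "abelian_subgroup K G"
  shows "\<exists>M. maximal_abelian_subgroup M G \<and> K \<subseteq> M"
proof -
  let ?S = "{M. abelian_subgroup M G \<and> K \<subseteq> M}"
  have "\<exists>M \<in> ?S. \<forall>X \<in> ?S. M \<subseteq> X \<longrightarrow> X = M"
  proof (rule subset_Zorn_nonempty)
    show "?S \<noteq> {}" using assms by blast
  next
    fix C assume C: "C \<noteq> {}" "subset.chain ?S C"
    have CS: "M \<in> ?S" if "M \<in> C" for M using C(2) that by (auto simp: subset.chain_def)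
    have two: "\<exists>M \<in> C. x \<in> M \<and> y \<in> M" if "x \<in> \<Union>C" "y \<in> \<Union>C" for x y
      using that C(2) unfolding subset_chain_def by blast
    have sub: "subgroup M G" and com: "\<forall>x \<in> M. \<forall>y \<in> M. x \<otimes> y = y \<otimes> x" if "M \<in> C" for M
      using CS[OF that] by (simp_all add: abelian_subgroup_iff)
    have "subgroup (\<Union>C) G"
    proof (rule subgroupI)
      show "\<Union>C \<subseteq> carrier G" using subgroup.subset[OF sub] by (meson Sup_least)
      show "\<Union>C \<noteq> {}" using C(1) subgroup.one_closed[OF sub] by blast
      show "inv a \<in> \<Union>C" if "a \<in> \<Union>C" for a
        using that subgroup.m_inv_closed[OF sub] by (meson UnionE UnionI)
      show "a \<otimes> b \<in> \<Union>C" if "a \<in> \<Union>C" "b \<in> \<Union>C" for a b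
        using two[OF that] subgroup.m_closed[OF sub] by (meson UnionI)
    qed
    moreover have "\<forall>x \<in> \<Union>C. \<forall>y \<in> \<Union>C. x \<otimes> y = y \<otimes> x" using two com by blast
    moreover have "K \<subseteq> \<Union>C" using C(1) CS by blast
    ultimately show "\<Union>C \<in> ?S" by (simp add: abelian_subgroup_iff)
  qed
  then obtain M where M: "abelian_subgroup M G" "K \<subseteq> M"
    and max: "\<And>X. abelian_subgroup X G \<Longrightarrow> K \<subseteq> X \<Longrightarrow> M \<subseteq> X \<Longrightarrow> X = M"
    by auto
  have "maximal_abelian_subgroup M G"
    unfolding maximal_abelian_subgroup_def using M max by (meson subset_trans)
  then show ?thesis using M(2) by (intro exI conjI)
qed

lemma malnormalD:
  assumes "malnormal H G" "x \<in> H" "x \<noteq> \<one>" "g \<in> carrier G" "conj_elt G x g \<in> H"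
  shows "g \<in> H"
proof (rule ccontr)
  assume "g \<notin> H"
  then have "H \<inter> conj_set G H g = {\<one>}" using assms unfolding malnormal_def by blast
  moreover have "conj_elt G x g \<in> H \<inter> conj_set G H g"
    using assms unfolding conj_set_def by blast
  ultimately have "conj_elt G x g = \<one>" by blast
  moreover have "x \<in> carrier G" using assms(1,2) subgroup.mem_carrier unfolding malnormal_def by metis
  ultimately show False
    using conj_elt_inj[of x \<one> g] assms(3,4) by simp
qed

text \<open>
  In a CSA group, let \<open>M\<close> be a maximal abelian subgroup containing \<open>h \<noteq> 1\<close>. By malnormality the
  centralizer of \<open>h\<close> lies in \<open>M\<close>, and \<open>h\<^sup>g \<in> M\<close> forces \<open>g \<in> M\<close>. Conversely, let \<open>z\<close> and \<open>z\<^sup>g\<close> be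
  nontrivial elements of a maximal abelian \<open>M\<close>. Then \<open>g\<close> commutes with \<open>z\<close>, and the centralizer of
  \<open>z\<close> is an abelian subgroup that contains \<open>M\<close>, hence equals \<open>M\<close>; so \<open>g \<in> M\<close>.
\<close>

lemma CSA_group_iff_tame:
  "CSA_group G \<longleftrightarrow> (\<forall>h \<in> carrier G. h \<noteq> \<one> \<longrightarrow> tame G h)"
proof
  assume csa: "CSA_group G"
  show "\<forall>h \<in> carrier G. h \<noteq> \<one> \<longrightarrow> tame G h"
  proof (intro ballI impI)
    fix h assume h: "h \<in> carrier G" "h \<noteq> \<one>"
    have "x \<otimes> y = y \<otimes> x" if "x \<in> generate G {h}" "y \<in> generate G {h}" for x y
      using that h by (auto simp: generate_pow int_pow_mult [symmetric] add.commute)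
    then have "abelian_subgroup (generate G {h}) G"
      using h generate_is_subgroup[of "{h}"] by (simp add: abelian_subgroup_iff)
    then obtain M where M: "maximal_abelian_subgroup M G" "generate G {h} \<subseteq> M"
      using maximal_abelian_subgroup_exists by blast
    have mal: "malnormal M G" using csa M(1) by (simp add: CSA_group_def)
    have hM: "h \<in> M" using M(2) generate.incl[of h "{h}" G] by auto
    have com: "\<forall>x \<in> M. \<forall>y \<in> M. x \<otimes> y = y \<otimes> x"
      using M(1) by (simp add: maximal_abelian_subgroup_def abelian_subgroup_iff)
    have cent: "x \<in> M" if "x \<in> carrier G" "h \<otimes> x = x \<otimes> h" for x
      using malnormalD[OF mal hM h(2) that(1)] conj_elt_eq_self_iff[OF h(1) that(1)] that hM by simp
    show "tame G h"
    proof (rule tameI)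
      show "x \<otimes> y = y \<otimes> x" if "x \<in> carrier G" "y \<in> carrier G" "h \<otimes> x = x \<otimes> h" "h \<otimes> y = y \<otimes> h" for x y
        using that cent com by blast
      show "h \<otimes> g = g \<otimes> h" if "g \<in> carrier G" "h \<otimes> conj_elt G h g = conj_elt G h g \<otimes> h" for g
      proof -
        have "conj_elt G h g \<in> M" using that h by (intro cent) auto
        then have "g \<in> M" using malnormalD[OF mal hM h(2) that(1)] by blast
        then show ?thesis using com hM by blast
      qed
    qed
  qed
next
  assume tame: "\<forall>h \<in> carrier G. h \<noteq> \<one> \<longrightarrow> tame G h"
  have "malnormal M G" if M: "maximal_abelian_subgroup M G" for M
    unfolding malnormal_def
  proof (intro conjI ballI)
    have com: "\<forall>x \<in> M. \<forall>y \<in> M. x \<otimes> y = y \<otimes> x"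
      using M by (simp add: maximal_abelian_subgroup_def abelian_subgroup_iff)
    show sub: "subgroup M G"
      using M by (simp add: maximal_abelian_subgroup_def abelian_subgroup_iff)
    fix g assume g: "g \<in> carrier G - M"
    have "y = \<one>" if y: "y \<in> M" "y \<in> conj_set G M g" for y
    proof (rule ccontr)
      assume "y \<noteq> \<one>"
      obtain z where z: "z \<in> M" "y = conj_elt G z g" using y(2) by (auto simp: conj_set_def)
      have zc: "z \<in> carrier G" using subgroup.mem_carrier[OF sub z(1)] .
      have "z \<noteq> \<one>" using z \<open>y \<noteq> \<one>\<close> g by auto
      then have tz: "tame G z" using tame zc by blast
      have "z \<otimes> g = g \<otimes> z" using tame_conj_elt[OF tz, of g] g com z y(1) by simp
      let ?C = "{x \<in> carrier G. z \<otimes> x = x \<otimes> z}"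
      have "abelian_subgroup ?C G" using tz zc by (rule abelian_subgroup_centralizer)
      moreover have "M \<subseteq> ?C" using subgroup.mem_carrier[OF sub] com z(1) by auto
      ultimately have "?C = M" using M unfolding maximal_abelian_subgroup_def by meson
      then show False using g \<open>z \<otimes> g = g \<otimes> z\<close> by blast
    qed
    moreover have "\<one> \<in> M" using subgroup.one_closed[OF sub] .
    moreover have "\<one> \<in> conj_set G M g"
      using \<open>\<one> \<in> M\<close> g by (auto simp: conj_set_def intro!: image_eqI[of _ _ \<one>])
    ultimately show "M \<inter> conj_set G M g = {\<one>}" by blast
  qed
  then show "CSA_group G" using is_group by (simp add: CSA_group_def)
qed

lemma ord_ne_two_iff:
  assumes "x \<in> carrier G"
  shows "ord x \<noteq> 2 \<longleftrightarrow> (x \<otimes> x = \<one> \<longrightarrow> x = \<one>)"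
proof -
  have sq: "x \<otimes> x = \<one> \<longleftrightarrow> ord x dvd 2"
    using pow_eq_id[OF assms, of 2] assms by (simp add: numeral_2_eq_2)
  have "ord x dvd 2 \<longleftrightarrow> ord x = 1 \<or> ord x = 2"
    using dvd_imp_le[of "ord x" 2] by (cases "ord x = 0") (auto simp: le_eq_less_or_eq less_2_cases_iff)
  then show ?thesis using sq ord_eq_1[OF assms] by auto
qed

lemma CSA_star_group_iff_tame:
  "CSA_star_group G \<longleftrightarrow>
    (\<forall>h \<in> carrier G. h \<noteq> \<one> \<longrightarrow> tame G h) \<and> (\<forall>x \<in> carrier G. x \<otimes> x = \<one> \<longrightarrow> x = \<one>)"
proof -
  have "(\<forall>x \<in> carrier G. ord x \<noteq> 2) \<longleftrightarrow> (\<forall>x \<in> carrier G. x \<otimes> x = \<one> \<longrightarrow> x = \<one>)"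
    by (rule ball_cong) (simp_all only: ord_ne_two_iff)
  then show ?thesis by (simp only: CSA_star_group_def CSA_group_iff_tame)
qed

end

section \<open>Reduced words and streams\<close>

type_synonym 'a letter = "'a set \<times> bool"

text \<open>
  The letter \<open>(x, True)\<close> stands for \<open>r u r\<inverse>\<close> if \<open>x\<close> is the coset \<open>r A\<close>, and \<open>(x, False)\<close> stands for
  the inverse of this element.
\<close>

definition linv :: "'a letter \<Rightarrow> 'a letter" where
  "linv l = (fst l, \<not> snd l)"

lemma linv_simps [simp]:
  "fst (linv l) = fst l" "snd (linv l) = (\<not> snd l)" "linv (linv l) = l" "linv (x, e) = (x, \<not> e)"
  "linv l = linv m \<longleftrightarrow> l = m" "linv l \<noteq> l" "l \<noteq> linv l"
  by (auto simp: linv_def prod_eq_iff)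

lemma stream_eqI: "(\<And>n. s !! n = t !! n) \<Longrightarrow> s = t"
  using smap_alt[of "\<lambda>x. x" s t] by (simp add: stream.map_ident)

definition reduced :: "'a letter list \<Rightarrow> bool" where
  "reduced = successively (\<lambda>l m. m \<noteq> linv l)"

definition sreduced :: "'a letter stream \<Rightarrow> bool" where
  "sreduced \<xi> \<longleftrightarrow> (\<forall>i. \<xi> !! Suc i \<noteq> linv (\<xi> !! i))"

lemma sreduced_Stream [simp]: "sreduced (l ## \<xi>) \<longleftrightarrow> shd \<xi> \<noteq> linv l \<and> sreduced \<xi>"
proof
  assume *: "sreduced (l ## \<xi>)"
  show "shd \<xi> \<noteq> linv l \<and> sreduced \<xi>"
    unfolding sreduced_def
  proof (intro conjI allI)
    show "shd \<xi> \<noteq> linv l" using *[unfolded sreduced_def, rule_format, of 0] by simp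
    show "\<xi> !! Suc i \<noteq> linv (\<xi> !! i)" for i
      using *[unfolded sreduced_def, rule_format, of "Suc i"] by simp
  qed
next
  assume *: "shd \<xi> \<noteq> linv l \<and> sreduced \<xi>"
  show "sreduced (l ## \<xi>)"
    unfolding sreduced_def
  proof
    show "(l ## \<xi>) !! Suc i \<noteq> linv ((l ## \<xi>) !! i)" for i
      using * by (cases i) (auto simp: sreduced_def)
  qed
qed

lemma sreduced_shift:
  "sreduced (w @- \<xi>) \<longleftrightarrow> reduced w \<and> sreduced \<xi> \<and> (w = [] \<or> shd \<xi> \<noteq> linv (last w))"
proof (induction w)
  case (Cons l w)
  then show ?case by (cases w) (auto simp: reduced_def)
qed (simp add: reduced_def)

lemma sreduced_stl: "sreduced \<xi> \<Longrightarrow> sreduced (stl \<xi>)"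
  by (metis sreduced_Stream stream.collapse)

lemma sreduced_sdrop: "sreduced \<xi> \<Longrightarrow> sreduced (sdrop n \<xi>)"
  by (metis sreduced_shift stake_sdrop)

lemma not_reduced_split:
  assumes "\<not> reduced w"
  obtains p l q where "w = p @ l # linv l # q"
  using assms
proof (induction w arbitrary: thesis)
  case (Cons l w)
  show ?case
  proof (cases "reduced w")
    case True
    then obtain q where "w = linv l # q"
      using Cons.prems(2) by (cases w) (auto simp: reduced_def)
    then show ?thesis using Cons.prems(1)[of "[]"] by simp
  next
    case False
    then obtain p m q where "w = p @ m # linv m # q" using Cons.IH by blast
    then show ?thesis using Cons.prems(1)[of "l # p"] by simp
  qed
qed (simp add: reduced_def)

text \<open>
  Left multiplication of a reduced infinite word by a letter in the free group.
\<close>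

definition push :: "'a letter \<Rightarrow> 'a letter stream \<Rightarrow> 'a letter stream" where
  "push l \<xi> = (if shd \<xi> = linv l then stl \<xi> else l ## \<xi>)"

lemma push_linv_push: "sreduced \<xi> \<Longrightarrow> push (linv l) (push l \<xi>) = \<xi>"
  by (cases \<xi>) (auto simp: push_def)

lemma sreduced_push: "sreduced \<xi> \<Longrightarrow> sreduced (push l \<xi>)"
  by (simp add: push_def sreduced_stl)

lemma sset_push: "sset (push l \<xi>) \<subseteq> insert (fst l, snd l) (sset \<xi>)"
  by (cases \<xi>) (auto simp: push_def)

text \<open>
  A reduced word that repeats one generator cannot change the sign of its exponent.
\<close>

lemma sreduced_constant:
  assumes "sreduced \<xi>" "\<And>i. fst (\<xi> !! i) = x"
  shows "\<xi> = sconst (x, snd (shd \<xi>))"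
proof -
  have "snd (\<xi> !! i) = snd (shd \<xi>)" for i
  proof (induction i)
    case (Suc i)
    have "\<xi> !! Suc i \<noteq> linv (\<xi> !! i)" using assms(1) unfolding sreduced_def by blast
    then show ?case using Suc assms(2)[of "Suc i"] assms(2)[of i]
      by (auto simp: prod_eq_iff simp del: snth.simps)
  qed simp
  then have "\<xi> !! i = (x, snd (shd \<xi>))" for i
    using assms(2)[of i] by (simp add: prod_eq_iff)
  then have "sset \<xi> = {(x, snd (shd \<xi>))}" by (auto simp: sset_range)
  then show ?thesis by (simp add: sconst_alt)
qed

lemma sreduced_sconst: "sreduced (sconst l)"
proof -
  have "sconst l !! i = l" for i by (induction i) (simp_all add: sconst_alt)
  then show ?thesis unfolding sreduced_def by (metis linv_simps(7))
qed

definition lact :: "('a, 'm) monoid_scheme \<Rightarrow> 'a \<Rightarrow> 'a letter \<Rightarrow> 'a letter" where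
  "lact G g l = (g <#\<^bsub>G\<^esub> fst l, snd l)"

lemma lact_linv [simp]: "lact G g (linv l) = linv (lact G g l)"
  by (simp add: lact_def linv_def)

lemma lact_Pair: "lact G g (x, e) = (g <#\<^bsub>G\<^esub> x, e)"
  by (simp add: lact_def)

lemma snd_lact [simp]: "snd (lact G g l) = snd l"
  by (simp add: lact_def)

text \<open>
  The first components may be arbitrary subsets of the group, not just cosets of \<open>A\<close>. The empty set
  is fixed by every group element and is not a coset, so a constant stream of letters
  \<open>({}, True)\<close> can play the role of the base vertex of the tree, and a finite word followed
  by this stream that of an arbitrary vertex. In this way one action serves both vertices and ends.
\<close>

definition stream_space :: "('a, 'm) monoid_scheme \<Rightarrow> 'a letter stream set" where
  "stream_space G = {\<xi>. sreduced \<xi> \<and> (\<forall>l \<in> sset \<xi>. fst l \<subseteq> carrier G)}"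

context group
begin

lemma lact_one: "fst l \<subseteq> carrier G \<Longrightarrow> lact G \<one> l = l"
  by (simp add: lact_def lcos_mult_one)

lemma lact_mult:
  "\<lbrakk>fst l \<subseteq> carrier G; g \<in> carrier G; h \<in> carrier G\<rbrakk> \<Longrightarrow> lact G (g \<otimes> h) l = lact G g (lact G h l)"
  by (simp add: lact_def lcos_m_assoc)

lemma lact_subset: "\<lbrakk>fst l \<subseteq> carrier G; g \<in> carrier G\<rbrakk> \<Longrightarrow> fst (lact G g l) \<subseteq> carrier G"
  by (simp add: lact_def l_coset_subset_G)

lemma lact_inv:
  assumes "fst l \<subseteq> carrier G" "g \<in> carrier G"
  shows "lact G (inv g) (lact G g l) = l" "lact G g (lact G (inv g) l) = l"
  using assms by (simp_all add: lact_mult [symmetric] lact_one)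

lemma lact_inj:
  assumes "fst l \<subseteq> carrier G" "fst m \<subseteq> carrier G" "g \<in> carrier G"
  shows "lact G g l = lact G g m \<longleftrightarrow> l = m"
  using lact_inv(1)[OF assms(1,3)] lact_inv(1)[OF assms(2,3)] by metis

lemma lact_eq_linv:
  assumes "fst l \<subseteq> carrier G" "fst m \<subseteq> carrier G" "g \<in> carrier G"
  shows "lact G g l = linv (lact G g m) \<longleftrightarrow> l = linv m"
  using lact_inj[of l "linv m" g] assms by simp

lemma stream_space_snth: "\<xi> \<in> stream_space G \<Longrightarrow> fst (\<xi> !! i) \<subseteq> carrier G"
  by (simp add: stream_space_def)

lemma smap_lact_closed:
  assumes "\<xi> \<in> stream_space G" "g \<in> carrier G"
  shows "smap (lact G g) \<xi> \<in> stream_space G"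
proof -
  have "sreduced (smap (lact G g) \<xi>)"
    unfolding sreduced_def
  proof
    fix i
    have "\<xi> !! Suc i \<noteq> linv (\<xi> !! i)" using assms(1) by (simp add: stream_space_def sreduced_def)
    then show "smap (lact G g) \<xi> !! Suc i \<noteq> linv (smap (lact G g) \<xi> !! i)"
      using lact_eq_linv[of "\<xi> !! Suc i" "\<xi> !! i" g] assms stream_space_snth[OF assms(1)]
      by (simp del: snth.simps)
  qed
  then show ?thesis
    using assms lact_subset by (auto simp: stream_space_def stream.set_map)
qed

lemma smap_lact_one: "\<xi> \<in> stream_space G \<Longrightarrow> smap (lact G \<one>) \<xi> = \<xi>"
  by (simp add: stream_space_def lact_one stream.map_ident cong: stream.map_cong)

lemma smap_lact_mult:
  assumes "\<xi> \<in> stream_space G" "g \<in> carrier G" "h \<in> carrier G"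
  shows "smap (lact G (g \<otimes> h)) \<xi> = smap (lact G g) (smap (lact G h) \<xi>)"
  using assms by (auto simp: stream_space_def stream.map_comp lact_mult intro!: stream.map_cong)

lemma push_closed:
  assumes "\<xi> \<in> stream_space G" "fst l \<subseteq> carrier G"
  shows "push l \<xi> \<in> stream_space G"
  using assms sset_push[of l \<xi>] sreduced_push[of \<xi> l] unfolding stream_space_def by auto

lemma smap_lact_push:
  assumes "\<xi> \<in> stream_space G" "fst l \<subseteq> carrier G" "g \<in> carrier G"
  shows "smap (lact G g) (push l \<xi>) = push (lact G g l) (smap (lact G g) \<xi>)"
proof -
  have "fst (shd \<xi>) \<subseteq> carrier G" using stream_space_snth[OF assms(1), of 0] by simp
  then show ?thesis
    using lact_eq_linv[of "shd \<xi>" l g] assms by (cases \<xi>) (auto simp: push_def)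
qed

end

section \<open>Elements of an extended centralizer as words\<close>

text \<open>
  The group \<open>H\<close> is generated by \<open>\<iota> G\<close> and an element \<open>u\<close> that commutes with \<open>\<iota> A\<close>. The action on
  streams expresses that there are no further relations: it makes \<open>\<iota>\<close> injective and
  distinguishes different reduced words.
\<close>

locale centralizer_extension = G: group G + H: group H
  for G :: "('a, 'm) monoid_scheme" and H :: "('h, 'n) monoid_scheme" (structure) +
  fixes A :: "'a set" and \<iota> :: "'a \<Rightarrow> 'h" and u :: 'h
    and act :: "'h \<Rightarrow> 'a letter stream \<Rightarrow> 'a letter stream"
  assumes A_subgroup: "subgroup A G"
    and A_comm: "a \<in> A \<Longrightarrow> b \<in> A \<Longrightarrow> a \<otimes>\<^bsub>G\<^esub> b = b \<otimes>\<^bsub>G\<^esub> a"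
    and A_malnormal: "malnormal A G"
    and G_tame: "g \<in> carrier G \<Longrightarrow> g \<noteq> \<one>\<^bsub>G\<^esub> \<Longrightarrow> tame G g"
    and G_no_involution: "g \<in> carrier G \<Longrightarrow> g \<otimes>\<^bsub>G\<^esub> g = \<one>\<^bsub>G\<^esub> \<Longrightarrow> g = \<one>\<^bsub>G\<^esub>"
    and \<iota>_hom: "\<iota> \<in> hom G H"
    and u_closed: "u \<in> carrier H"
    and u_comm: "a \<in> A \<Longrightarrow> u \<otimes> \<iota> a = \<iota> a \<otimes> u"
    and H_generated: "carrier H \<subseteq> generate H (insert u (\<iota> ` carrier G))"
    and act_closed: "x \<in> carrier H \<Longrightarrow> \<xi> \<in> stream_space G \<Longrightarrow> act x \<xi> \<in> stream_space G"
    and act_mult: "x \<in> carrier H \<Longrightarrow> y \<in> carrier H \<Longrightarrow> \<xi> \<in> stream_space G \<Longrightarrow>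
      act (x \<otimes> y) \<xi> = act x (act y \<xi>)"
    and act_\<iota>: "g \<in> carrier G \<Longrightarrow> \<xi> \<in> stream_space G \<Longrightarrow> act (\<iota> g) \<xi> = smap (lact G g) \<xi>"
    and act_u: "\<xi> \<in> stream_space G \<Longrightarrow> act u \<xi> = push (A, True) \<xi>"
begin

sublocale \<iota>: group_hom G H \<iota>
  by unfold_locales (rule \<iota>_hom)

lemma A_subset: "A \<subseteq> carrier G"
  using A_subgroup by (rule subgroup.subset)

definition points :: "'a set set" where
  "points = (\<lambda>r. r <#\<^bsub>G\<^esub> A) ` carrier G"

definition letters :: "'a letter set" where
  "letters = points \<times> UNIV"

definition ends :: "'a letter stream set" where
  "ends = {\<xi> \<in> stream_space G. sset \<xi> \<subseteq> letters}"

definition u_pm :: "bool \<Rightarrow> 'h" where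
  "u_pm e = (if e then u else inv u)"

text \<open>
  The choice of the representative is immaterial by \<open>letter_elt_coset\<close>.
\<close>

definition letter_elt :: "'a letter \<Rightarrow> 'h" where
  "letter_elt l = (let r = \<iota> (SOME r. r \<in> fst l) in r \<otimes> u_pm (snd l) \<otimes> inv r)"

definition word_elt :: "'a letter list \<Rightarrow> 'h" where
  "word_elt w = foldr (\<lambda>l y. letter_elt l \<otimes> y) w \<one>"

lemma u_pm_closed [simp]: "u_pm e \<in> carrier H"
  by (simp add: u_pm_def u_closed)

lemma u_pm_comm: "a \<in> A \<Longrightarrow> \<iota> a \<otimes> u_pm e = u_pm e \<otimes> \<iota> a"
  using u_comm[of a] A_subset u_closed by (auto simp: u_pm_def intro!: H.commute_inv)

lemma u_pm_not: "u_pm (\<not> e) = inv (u_pm e)"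
  by (simp add: u_pm_def u_closed)

lemma points_subset: "x \<in> points \<Longrightarrow> x \<subseteq> carrier G"
  using G.l_coset_subset_G[OF A_subset] unfolding points_def by blast

lemma letters_subset: "l \<in> letters \<Longrightarrow> fst l \<subseteq> carrier G"
  using points_subset by (simp add: letters_def mem_Times_iff)

lemma A_in_points: "A \<in> points"
  using A_subset unfolding points_def by (intro image_eqI[of _ _ "\<one>\<^bsub>G\<^esub>"]) (simp_all add: G.lcos_mult_one)

lemma points_nonempty: "{} \<notin> points"
  using G.lcos_self[OF _ A_subgroup] by (auto simp: points_def)

lemma act_points: "g \<in> carrier G \<Longrightarrow> x \<in> points \<Longrightarrow> g <#\<^bsub>G\<^esub> x \<in> points"
  using A_subset by (auto simp: points_def G.lcos_m_assoc)

lemma lact_letters: "g \<in> carrier G \<Longrightarrow> l \<in> letters \<Longrightarrow> lact G g l \<in> letters"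
  by (auto simp: letters_def lact_def act_points)

lemma linv_letters [simp]: "linv l \<in> letters \<longleftrightarrow> l \<in> letters"
  by (simp add: letters_def mem_Times_iff)

lemma coset_fix_iff:
  assumes "g \<in> carrier G" "r \<in> carrier G"
  shows "g <#\<^bsub>G\<^esub> (r <#\<^bsub>G\<^esub> A) = r <#\<^bsub>G\<^esub> A \<longleftrightarrow> conj_elt G g r \<in> A"
proof -
  have "g <#\<^bsub>G\<^esub> (r <#\<^bsub>G\<^esub> A) = (g \<otimes>\<^bsub>G\<^esub> r) <#\<^bsub>G\<^esub> A"
    using assms A_subset by (simp add: G.lcos_m_assoc)
  also have "\<dots> = r <#\<^bsub>G\<^esub> A \<longleftrightarrow> g \<otimes>\<^bsub>G\<^esub> r \<in> r <#\<^bsub>G\<^esub> A"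
    using G.lcos_self[OF _ A_subgroup] G.l_repr_independence[OF _ _ A_subgroup] assms
    by (metis G.m_closed)
  also have "\<dots> \<longleftrightarrow> inv\<^bsub>G\<^esub> r \<otimes>\<^bsub>G\<^esub> (g \<otimes>\<^bsub>G\<^esub> r) \<in> A"
    using assms subgroup.lcos_module_imp[OF A_subgroup G.is_group, of r "g \<otimes>\<^bsub>G\<^esub> r"]
      subgroup.lcos_module_rev[OF A_subgroup G.is_group, of r "g \<otimes>\<^bsub>G\<^esub> r"] by auto
  finally show ?thesis using assms by (simp add: conj_elt_def G.m_assoc)
qed

lemma A_fix: "a \<in> carrier G \<Longrightarrow> a <#\<^bsub>G\<^esub> A = A \<longleftrightarrow> a \<in> A"
  using coset_fix_iff[of a "\<one>\<^bsub>G\<^esub>"] A_subset by (simp add: conj_elt_def G.lcos_mult_one)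

text \<open>
  The stabilizers of the cosets \<open>r A\<close> and \<open>q A\<close> are the conjugates of \<open>A\<close> by \<open>r\<inverse>\<close> and \<open>q\<inverse>\<close>, which
  intersect trivially by malnormality unless the cosets coincide.
\<close>

lemma fixed_point_unique:
  assumes g: "g \<in> carrier G" "g \<noteq> \<one>\<^bsub>G\<^esub>"
    and x: "x \<in> points" "g <#\<^bsub>G\<^esub> x = x" and y: "y \<in> points" "g <#\<^bsub>G\<^esub> y = y"
  shows "x = y"
proof -
  obtain r where r: "r \<in> carrier G" "x = r <#\<^bsub>G\<^esub> A" using x(1) by (auto simp: points_def)
  obtain q where q: "q \<in> carrier G" "y = q <#\<^bsub>G\<^esub> A" using y(1) by (auto simp: points_def)
  define k where "k = inv\<^bsub>G\<^esub> r \<otimes>\<^bsub>G\<^esub> q"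
  have k: "k \<in> carrier G" using r q by (simp add: k_def)
  have q_eq: "q = r \<otimes>\<^bsub>G\<^esub> k" using r q by (simp add: k_def)
  have a: "conj_elt G g r \<in> A" using coset_fix_iff g(1) r x(2) by simp
  moreover have "conj_elt G g r \<noteq> \<one>\<^bsub>G\<^esub>"
    using G.conj_elt_inj[of g "\<one>\<^bsub>G\<^esub>" r] g r by simp
  moreover have "conj_elt G (conj_elt G g r) k \<in> A"
    using coset_fix_iff g(1) q y(2) r k by (simp add: q_eq G.conj_elt_conj_elt)
  ultimately have "k \<in> A" using G.malnormalD[OF A_malnormal _ _ k] by blast
  then have "k <#\<^bsub>G\<^esub> A = A" using A_fix k by simp
  then show ?thesis using r q k A_subset by (simp add: q_eq G.lcos_m_assoc [symmetric])
qed

text \<open>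
  Two representatives differ by an element of \<open>A\<close>, and this element commutes with \<open>u\<close>.
\<close>

lemma letter_elt_coset:
  assumes r: "r \<in> carrier G"
  shows "letter_elt (r <#\<^bsub>G\<^esub> A, e) = \<iota> r \<otimes> u_pm e \<otimes> inv (\<iota> r)"
proof -
  define q where "q = (SOME q. q \<in> r <#\<^bsub>G\<^esub> A)"
  have "q \<in> r <#\<^bsub>G\<^esub> A" unfolding q_def using G.lcos_self[OF r A_subgroup] by (rule someI)
  then obtain a where a: "a \<in> A" "q = r \<otimes>\<^bsub>G\<^esub> a" by (auto simp: l_coset_def)
  have ac: "a \<in> carrier G" using a A_subset by blast
  have "letter_elt (r <#\<^bsub>G\<^esub> A, e) = \<iota> r \<otimes> (\<iota> a \<otimes> u_pm e) \<otimes> inv (\<iota> r \<otimes> \<iota> a)"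
    using r ac by (simp add: letter_elt_def q_def [symmetric] a(2) H.m_assoc)
  also have "\<dots> = \<iota> r \<otimes> u_pm e \<otimes> inv (\<iota> r)"
    using r ac by (simp add: u_pm_comm[OF a(1)] H.m_assoc H.inv_mult_group)
  finally show ?thesis .
qed

lemma letterE:
  assumes "l \<in> letters"
  obtains r e where "r \<in> carrier G" "l = (r <#\<^bsub>G\<^esub> A, e)"
  using assms by (auto simp: letters_def points_def)

lemma letter_elt_A [simp]: "letter_elt (A, e) = u_pm e"
  using letter_elt_coset[of "\<one>\<^bsub>G\<^esub>" e] A_subset by (simp add: G.lcos_mult_one)

lemma letter_elt_closed [simp]: "l \<in> letters \<Longrightarrow> letter_elt l \<in> carrier H"
  by (elim letterE) (simp add: letter_elt_coset)

lemma letter_elt_linv: "l \<in> letters \<Longrightarrow> letter_elt (linv l) = inv (letter_elt l)"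
  by (elim letterE) (simp add: letter_elt_coset u_pm_not H.inv_mult_group H.m_assoc)

lemma letter_elt_lact:
  assumes "g \<in> carrier G" "l \<in> letters"
  shows "\<iota> g \<otimes> letter_elt l = letter_elt (lact G g l) \<otimes> \<iota> g"
proof -
  obtain r e where r: "r \<in> carrier G" "l = (r <#\<^bsub>G\<^esub> A, e)" using assms(2) by (rule letterE)
  have "lact G g l = ((g \<otimes>\<^bsub>G\<^esub> r) <#\<^bsub>G\<^esub> A, e)"
    using r assms(1) A_subset by (simp add: lact_def G.lcos_m_assoc)
  then show ?thesis using r assms(1) by (simp add: letter_elt_coset H.m_assoc H.inv_mult_group)
qed

lemma word_elt_simps [simp]:
  "word_elt [] = \<one>" "word_elt (l # w) = letter_elt l \<otimes> word_elt w"
  by (simp_all add: word_elt_def)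

lemma word_elt_closed [simp]: "set w \<subseteq> letters \<Longrightarrow> word_elt w \<in> carrier H"
  by (induction w) auto

lemma word_elt_append: "set v \<subseteq> letters \<Longrightarrow> set w \<subseteq> letters \<Longrightarrow> word_elt (v @ w) = word_elt v \<otimes> word_elt w"
  by (induction v) (auto simp: H.m_assoc)

lemma set_map_lact: "g \<in> carrier G \<Longrightarrow> set w \<subseteq> letters \<Longrightarrow> set (map (lact G g) w) \<subseteq> letters"
  using lact_letters by auto

lemma word_elt_lact:
  assumes "g \<in> carrier G" "set w \<subseteq> letters"
  shows "\<iota> g \<otimes> word_elt w = word_elt (map (lact G g) w) \<otimes> \<iota> g"
  using assms(2)
proof (induction w)
  case (Cons l w)
  have l: "l \<in> letters" and w: "set w \<subseteq> letters" using Cons.prems by auto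
  have gw: "word_elt (map (lact G g) w) \<in> carrier H" and gl: "letter_elt (lact G g l) \<in> carrier H"
    using set_map_lact[OF assms(1) w] lact_letters[OF assms(1) l] by simp_all
  have "\<iota> g \<otimes> word_elt (l # w) = (\<iota> g \<otimes> letter_elt l) \<otimes> word_elt w"
    using l w assms(1) by (simp add: H.m_assoc)
  also have "\<dots> = letter_elt (lact G g l) \<otimes> (\<iota> g \<otimes> word_elt w)"
    using l w assms(1) gl by (simp add: letter_elt_lact H.m_assoc)
  also have "\<dots> = word_elt (map (lact G g) (l # w)) \<otimes> \<iota> g"
    using w assms(1) gl gw by (simp add: Cons.IH[OF w] H.m_assoc)
  finally show ?case .
qed (use assms(1) in simp)

lemma normal_form_mult:
  assumes "set v \<subseteq> letters" "set w \<subseteq> letters" "g \<in> carrier G" "h \<in> carrier G"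
  shows "(word_elt v \<otimes> \<iota> g) \<otimes> (word_elt w \<otimes> \<iota> h) = word_elt (v @ map (lact G g) w) \<otimes> \<iota> (g \<otimes>\<^bsub>G\<^esub> h)"
proof -
  note gw = set_map_lact[OF assms(3,2)]
  have "(word_elt v \<otimes> \<iota> g) \<otimes> (word_elt w \<otimes> \<iota> h) = word_elt v \<otimes> ((\<iota> g \<otimes> word_elt w) \<otimes> \<iota> h)"
    using assms by (simp add: H.m_assoc)
  also have "\<dots> = word_elt (v @ map (lact G g) w) \<otimes> \<iota> (g \<otimes>\<^bsub>G\<^esub> h)"
    using assms gw by (simp only: word_elt_lact word_elt_append) (simp add: H.m_assoc)
  finally show ?thesis .
qed

text \<open>
  Elements of \<open>G\<close> can be moved past letters at the cost of permuting the letters, so the products of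
  this shape are closed under multiplication.
\<close>

lemma normal_formE:
  assumes "x \<in> carrier H"
  obtains w g where "set w \<subseteq> letters" "g \<in> carrier G" "x = word_elt w \<otimes> \<iota> g"
proof -
  have "x \<in> generate H (insert u (\<iota> ` carrier G))" using assms H_generated by blast
  then have "\<exists>w g. set w \<subseteq> letters \<and> g \<in> carrier G \<and> x = word_elt w \<otimes> \<iota> g"
  proof induction
    case one
    then show ?case by (intro exI[of _ "[]"] exI[of _ "\<one>\<^bsub>G\<^esub>"]) simp
  next
    case (incl h)
    then consider "h = u" | g where "g \<in> carrier G" "h = \<iota> g" by blast
    then show ?case
    proof cases
      case 1
      then show ?thesis using A_in_points u_closed
        by (intro exI[of _ "[(A, True)]"] exI[of _ "\<one>\<^bsub>G\<^esub>"]) (simp add: letters_def u_pm_def)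
    next
      case 2
      then show ?thesis by (intro exI[of _ "[]"] exI[of _ g]) simp
    qed
  next
    case (inv h)
    then consider "h = u" | g where "g \<in> carrier G" "h = \<iota> g" by blast
    then show ?case
    proof cases
      case 1
      then show ?thesis using A_in_points u_closed
        by (intro exI[of _ "[(A, False)]"] exI[of _ "\<one>\<^bsub>G\<^esub>"]) (simp add: letters_def u_pm_def)
    next
      case 2
      then show ?thesis by (intro exI[of _ "[]"] exI[of _ "inv\<^bsub>G\<^esub> g"]) simp
    qed
  next
    case (eng x y)
    then obtain v g w h where "set v \<subseteq> letters" "g \<in> carrier G" "x = word_elt v \<otimes> \<iota> g"
      "set w \<subseteq> letters" "h \<in> carrier G" "y = word_elt w \<otimes> \<iota> h" by blast
    then show ?case using normal_form_mult[of v w g h] set_map_lact[of g w]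
      by (intro exI[of _ "v @ map (lact G g) w"] exI[of _ "g \<otimes>\<^bsub>G\<^esub> h"]) simp
  qed
  then show thesis using that by blast
qed

lemma act_one [simp]: "\<xi> \<in> stream_space G \<Longrightarrow> act \<one> \<xi> = \<xi>"
  using act_\<iota>[of "\<one>\<^bsub>G\<^esub>" \<xi>] by (simp add: G.smap_lact_one)

lemma act_inv:
  assumes "x \<in> carrier H" "\<xi> \<in> stream_space G"
  shows "act (inv x) (act x \<xi>) = \<xi>" "act x (act (inv x) \<xi>) = \<xi>"
  using assms by (simp_all add: act_mult [symmetric])

lemma act_u_pm:
  assumes "\<xi> \<in> stream_space G"
  shows "act (u_pm e) \<xi> = push (A, e) \<xi>"
proof (cases e)
  case False
  have p: "push (A, False) \<xi> \<in> stream_space G" using assms A_subset by (simp add: G.push_closed)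
  have "\<xi> = act u (push (A, False) \<xi>)"
    using push_linv_push[of \<xi> "(A, False)"] assms p by (simp add: act_u stream_space_def)
  then have "act (inv u) \<xi> = push (A, False) \<xi>" using act_inv(1)[OF u_closed p] by simp
  then show ?thesis using False by (simp add: u_pm_def)
qed (use assms act_u in \<open>simp add: u_pm_def\<close>)

lemma act_letter_elt:
  assumes "l \<in> letters" "\<xi> \<in> stream_space G"
  shows "act (letter_elt l) \<xi> = push l \<xi>"
proof -
  obtain r e where r: "r \<in> carrier G" "l = (r <#\<^bsub>G\<^esub> A, e)" using assms(1) by (rule letterE)
  let ?\<eta> = "act (inv (\<iota> r)) \<xi>"
  have eta: "?\<eta> \<in> stream_space G" using r assms(2) by (simp add: act_closed)
  have "act (letter_elt l) \<xi> = act (\<iota> r) (push (A, e) ?\<eta>)"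
    using r assms(2) eta by (simp add: letter_elt_coset act_mult act_closed act_u_pm)
  also have "\<dots> = push l (act (\<iota> r) ?\<eta>)"
    using r eta A_subset by (simp add: act_\<iota> G.push_closed G.smap_lact_push lact_Pair act_closed)
  finally show ?thesis using r assms(2) by (simp add: act_inv)
qed

lemma ends_space: "\<xi> \<in> ends \<Longrightarrow> \<xi> \<in> stream_space G"
  by (simp add: ends_def)

lemma endsI: "sreduced \<xi> \<Longrightarrow> sset \<xi> \<subseteq> letters \<Longrightarrow> \<xi> \<in> ends"
  using letters_subset by (auto simp: ends_def stream_space_def)

lemma endsD: "\<xi> \<in> ends \<Longrightarrow> sreduced \<xi>" "\<xi> \<in> ends \<Longrightarrow> sset \<xi> \<subseteq> letters"
  by (simp_all add: ends_def stream_space_def)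

lemma push_ends: "l \<in> letters \<Longrightarrow> \<xi> \<in> ends \<Longrightarrow> push l \<xi> \<in> ends"
  using sset_push[of l \<xi>] by (intro endsI) (auto simp: sreduced_push endsD dest: endsD(2))

lemma smap_lact_ends: "g \<in> carrier G \<Longrightarrow> \<xi> \<in> ends \<Longrightarrow> smap (lact G g) \<xi> \<in> ends"
  using G.smap_lact_closed[of \<xi> g] lact_letters by (auto simp: ends_def stream.set_map)

lemma act_word_elt:
  assumes "set w \<subseteq> letters" "w @- \<xi> \<in> stream_space G"
  shows "act (word_elt w) \<xi> = w @- \<xi>"
  using assms
proof (induction w)
  case (Cons l w)
  have w: "w @- \<xi> \<in> stream_space G" using Cons.prems(2) by (simp add: stream_space_def)
  have xi: "\<xi> \<in> stream_space G"
    using w by (auto simp: stream_space_def sreduced_shift)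
  have "shd (w @- \<xi>) \<noteq> linv l" using Cons.prems(2) by (simp add: stream_space_def)
  then have "push l (w @- \<xi>) = l ## w @- \<xi>" by (simp add: push_def)
  then show ?case using Cons w xi by (simp add: act_mult act_letter_elt)
qed simp

lemma act_word_elt_ends:
  assumes "set w \<subseteq> letters" "\<xi> \<in> ends"
  shows "act (word_elt w) \<xi> \<in> ends"
  using assms(1)
proof (induction w)
  case (Cons l w)
  then show ?case using assms(2) by (simp add: act_mult act_letter_elt ends_space push_ends)
qed (use assms(2) in \<open>simp add: ends_space\<close>)

lemma act_ends:
  assumes "x \<in> carrier H" "\<xi> \<in> ends"
  shows "act x \<xi> \<in> ends"
proof -
  obtain w g where w: "set w \<subseteq> letters" "g \<in> carrier G" "x = word_elt w \<otimes> \<iota> g"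
    using assms(1) by (rule normal_formE)
  have "act (\<iota> g) \<xi> \<in> ends" using assms(2) w(2) by (simp add: act_\<iota> ends_space smap_lact_ends)
  then show ?thesis using w assms(2) by (simp add: act_mult ends_space act_word_elt_ends)
qed

text \<open>
  The streams whose letters are singletons see the regular representation of \<open>G\<close>.
\<close>

lemma \<iota>_inj:
  assumes "g \<in> carrier G" "h \<in> carrier G" "\<iota> g = \<iota> h"
  shows "g = h"
proof -
  let ?\<xi> = "sconst ({\<one>\<^bsub>G\<^esub>}, True)"
  have "?\<xi> \<in> stream_space G" by (simp add: stream_space_def sreduced_sconst)
  then have "smap (lact G g) ?\<xi> = smap (lact G h) ?\<xi>"
    using act_\<iota>[of g ?\<xi>] act_\<iota>[of h ?\<xi>] assms by simp
  then have "sset (smap (lact G g) ?\<xi>) = sset (smap (lact G h) ?\<xi>)" by simp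
  then show ?thesis using assms by (simp add: stream.set_map lact_def l_coset_def)
qed

text \<open>
  The base vertex of the tree; its stabilizer is \<open>G\<close>.
\<close>

definition basepoint :: "'a letter stream" where
  "basepoint = sconst ({}, True)"

lemma basepoint_space: "basepoint \<in> stream_space G"
  by (simp add: basepoint_def stream_space_def sreduced_sconst)

lemma act_\<iota>_basepoint: "g \<in> carrier G \<Longrightarrow> act (\<iota> g) basepoint = basepoint"
  using basepoint_space by (simp add: act_\<iota>) (simp add: basepoint_def smap_sconst lact_def l_coset_def)

lemma shd_basepoint: "shd basepoint = ({}, True)"
  by (simp add: basepoint_def)

lemma shift_basepoint_space:
  assumes "set w \<subseteq> letters" "reduced w"
  shows "w @- basepoint \<in> stream_space G"
proof -
  have "fst (last w) \<noteq> {}" if "w \<noteq> []"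
    using subsetD[OF assms(1) last_in_set[OF that]] points_nonempty
    by (auto simp: letters_def mem_Times_iff)
  then have "w = [] \<or> shd basepoint \<noteq> linv (last w)" by (auto simp: shd_basepoint prod_eq_iff)
  then show ?thesis using assms basepoint_space letters_subset
    by (auto simp: stream_space_def sreduced_shift)
qed

lemma act_normal_form_basepoint:
  assumes "set w \<subseteq> letters" "reduced w" "g \<in> carrier G"
  shows "act (word_elt w \<otimes> \<iota> g) basepoint = w @- basepoint"
  using assms basepoint_space shift_basepoint_space[OF assms(1,2)]
  by (simp add: act_mult act_\<iota>_basepoint act_word_elt)

lemma letter_ne_shd_basepoint: "l \<in> letters \<Longrightarrow> l \<noteq> shd basepoint"
  using points_nonempty by (auto simp: letters_def shd_basepoint)

lemma shift_basepoint_inj: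
  assumes "set v \<subseteq> letters" "set w \<subseteq> letters" "v @- basepoint = w @- basepoint"
  shows "v = w"
  using assms
proof (induction v arbitrary: w)
  case Nil
  then have "shd basepoint = shd (w @- basepoint)" by simp
  then show ?case using Nil letter_ne_shd_basepoint by (cases w) auto
next
  case (Cons l v)
  have "shd ((l # v) @- basepoint) = shd (w @- basepoint)" using Cons.prems(3) by (rule arg_cong)
  moreover have "l \<noteq> shd basepoint" using letter_ne_shd_basepoint Cons.prems(1) by simp
  ultimately obtain w' where "w = l # w'" by (cases w) auto
  then show ?case using Cons by simp
qed

section \<open>Fixed ends\<close>

lemma reduced_normal_formE:
  assumes "x \<in> carrier H"
  obtains w g where "set w \<subseteq> letters" "reduced w" "g \<in> carrier G" "x = word_elt w \<otimes> \<iota> g"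
proof -
  have "\<exists>v. set v \<subseteq> letters \<and> reduced v \<and> word_elt v = word_elt w" if "set w \<subseteq> letters" for w
    using that
  proof (induction w rule: length_induct)
    case (1 w)
    show ?case
    proof (cases "reduced w")
      case False
      then obtain p l q where w: "w = p @ l # linv l # q" by (rule not_reduced_split)
      have pq: "set p \<subseteq> letters" "set q \<subseteq> letters" "l \<in> letters" using "1.prems" w by auto
      then have "word_elt w = word_elt (p @ q)" by (simp add: w word_elt_append letter_elt_linv)
      then show ?thesis using "1.IH"[rule_format, of "p @ q"] pq by (auto simp: w)
    qed (use "1.prems" in blast)
  qed
  then show thesis using normal_formE[OF assms] that by metis
qed

text \<open>
  No cancellation occurs in powers of \<open>w g\<close>: in \<open>w g w g\<close> the last letter of the first \<open>w\<close> meets the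
  image under \<open>g\<close> of the first letter of the second one.
\<close>

definition cyc_reduced :: "'a letter list \<Rightarrow> 'a \<Rightarrow> bool" where
  "cyc_reduced w g \<longleftrightarrow> reduced w \<and> (w \<noteq> [] \<longrightarrow> lact G g (hd w) \<noteq> linv (last w))"

text \<open>
  A word with a cancelling pair can be shortened without changing the element. If \<open>w g\<close> is not
  cyclically reduced, conjugating by the first letter of \<open>w\<close> removes the first and the last letter.
  These are different letters of \<open>w\<close>, because \<open>G\<close> preserves the signs of letters and so cannot
  map a letter to its inverse.
\<close>

lemma cyc_reduced_conjugate:
  assumes "x \<in> carrier H"
  obtains k w g where "k \<in> carrier H" "set w \<subseteq> letters" "g \<in> carrier G" "cyc_reduced w g"
    "conj_elt H x k = word_elt w \<otimes> \<iota> g"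
proof -
  have *: "\<exists>k v h. k \<in> carrier H \<and> set v \<subseteq> letters \<and> h \<in> carrier G \<and> cyc_reduced v h \<and>
      conj_elt H (word_elt w \<otimes> \<iota> g) k = word_elt v \<otimes> \<iota> h"
    if "set w \<subseteq> letters" "g \<in> carrier G" for w g
    using that(1)
  proof (induction w rule: length_induct)
    case (1 w)
    show ?case
    proof (cases "reduced w")
      case False
      then obtain p l q where w: "w = p @ l # linv l # q" by (rule not_reduced_split)
      have pq: "set p \<subseteq> letters" "set q \<subseteq> letters" "l \<in> letters" using "1.prems" w by auto
      then have "word_elt w = word_elt (p @ q)" by (simp add: w word_elt_append letter_elt_linv)
      then show ?thesis using "1.IH"[rule_format, of "p @ q"] pq by (simp add: w)
    next
      case True
      show ?thesis
      proof (cases "cyc_reduced w g")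
        case cyc: True
        have "conj_elt H (word_elt w \<otimes> \<iota> g) \<one> = word_elt w \<otimes> \<iota> g"
          using "1.prems" that(2) by (simp add: conj_elt_def)
        then show ?thesis using cyc "1.prems" that(2) H.one_closed by blast
      next
        case False
        then have ne: "w \<noteq> []" and cancel: "lact G g (hd w) = linv (last w)"
          using True by (auto simp: cyc_reduced_def)
        obtain l w' where w': "w = l # w'" using ne by (cases w) auto
        have "w' \<noteq> []"
        proof
          assume "w' = []"
          then have "snd (lact G g l) = snd (linv l)" using cancel w' by simp
          then show False by simp
        qed
        then obtain v m where w: "w = l # v @ [m]" using w' by (metis rev_exhaust)
        have lvm: "l \<in> letters" "m \<in> letters" "set v \<subseteq> letters" using "1.prems" w by auto
        have m: "lact G g l = linv m" using cancel by (simp add: w)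
        have "(word_elt w \<otimes> \<iota> g) \<otimes> letter_elt l = word_elt w \<otimes> (\<iota> g \<otimes> letter_elt l)"
          using "1.prems" that(2) lvm by (simp add: H.m_assoc)
        also have "\<dots> = letter_elt l \<otimes> (word_elt v \<otimes> \<iota> g)"
          using that(2) lvm by (simp add: w letter_elt_lact m letter_elt_linv word_elt_append H.m_assoc)
        finally have "conj_elt H (word_elt w \<otimes> \<iota> g) (letter_elt l) = word_elt v \<otimes> \<iota> g"
          using "1.prems" that(2) lvm by (simp add: conj_elt_def H.m_assoc)
        moreover obtain k v' h where k: "k \<in> carrier H" "set v' \<subseteq> letters" "h \<in> carrier G"
          "cyc_reduced v' h" "conj_elt H (word_elt v \<otimes> \<iota> g) k = word_elt v' \<otimes> \<iota> h"
          using "1.IH"[rule_format, of v] lvm(3) by (auto simp: w)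
        ultimately have "conj_elt H (word_elt w \<otimes> \<iota> g) (letter_elt l \<otimes> k) = word_elt v' \<otimes> \<iota> h"
          using "1.prems" that(2) lvm by (simp add: H.conj_elt_conj_elt [symmetric])
        then show ?thesis using k lvm(1) by (metis H.m_closed letter_elt_closed)
      qed
    qed
  qed
  obtain w g where w: "set w \<subseteq> letters" "g \<in> carrier G" "x = word_elt w \<otimes> \<iota> g"
    using assms by (rule normal_formE)
  then show thesis using *[OF w(1,2)] that by metis
qed

definition fixed_ends :: "'h \<Rightarrow> 'a letter stream set" where
  "fixed_ends x = {\<xi> \<in> ends. act x \<xi> = \<xi>}"

text \<open>
  The infinite word \<open>w (g w) (g\<^sup>2 w) \<dots>\<close>. If \<open>w g\<close> is cyclically reduced, this is the end towards which
  it translates.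
\<close>

definition axis :: "'a letter list \<Rightarrow> 'a \<Rightarrow> 'a letter stream" where
  "axis w g = smap (\<lambda>i. (lact G g ^^ (i div length w)) (w ! (i mod length w))) nats"

lemma axis_unfold:
  assumes "w \<noteq> []"
  shows "axis w g = w @- smap (lact G g) (axis w g)"
proof -
  have "axis w g !! i = (w @- smap (lact G g) (axis w g)) !! i" for i
    using assms by (auto simp: axis_def shift_snth le_div_geq le_mod_geq not_less)
  then show ?thesis by (rule stream_eqI)
qed

text \<open>
  The equation determines the letters of \<open>\<eta>\<close> one block of length \<open>|w|\<close> after the other.
\<close>

lemma axis_unique:
  assumes "w \<noteq> []" "\<eta> = w @- smap (lact G g) \<eta>"
  shows "\<eta> = axis w g"
proof (rule stream_eqI)
  fix i
  show "\<eta> !! i = axis w g !! i"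
  proof (induction i rule: less_induct)
    case (less i)
    show ?case
    proof (cases "i < length w")
      case True
      then show ?thesis
        using arg_cong[OF assms(2), of "\<lambda>s. s !! i"]
          arg_cong[OF axis_unfold[OF assms(1)], of "\<lambda>s. s !! i" g] by simp
    next
      case False
      then have "\<eta> !! (i - length w) = axis w g !! (i - length w)"
        using assms(1) False by (intro less.IH) (cases w; simp)
      then show ?thesis
        using False arg_cong[OF assms(2), of "\<lambda>s. s !! i"]
          arg_cong[OF axis_unfold[OF assms(1)], of "\<lambda>s. s !! i" g] by simp
    qed
  qed
qed

lemma axis_snth_less: "i < length w \<Longrightarrow> axis w g !! i = w ! i"
  by (simp add: axis_def)

lemma axis_snth_ge:
  "w \<noteq> [] \<Longrightarrow> \<not> i < length w \<Longrightarrow> axis w g !! i = lact G g (axis w g !! (i - length w))"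
  by (simp add: axis_def le_div_geq le_mod_geq not_less)

lemma shd_axis: "w \<noteq> [] \<Longrightarrow> shd (axis w g) = hd w"
  using axis_snth_less[of 0 w g] by (simp add: hd_conv_nth)

lemma axis_ends:
  assumes w: "w \<noteq> []" "set w \<subseteq> letters" and g: "g \<in> carrier G" and cyc: "cyc_reduced w g"
  shows "axis w g \<in> ends"
proof (rule endsI)
  have in_letters: "axis w g !! i \<in> letters" for i
  proof (induction i rule: less_induct)
    case (less i)
    show ?case
    proof (cases "i < length w")
      case True
      then show ?thesis using w(2) by (auto simp: axis_snth_less)
    next
      case False
      then have "axis w g !! (i - length w) \<in> letters" using w(1) False by (intro less.IH) (cases w; simp)
      then show ?thesis using False w(1) g by (simp add: axis_snth_ge lact_letters)
    qed
  qed
  then show "sset (axis w g) \<subseteq> letters" by (auto simp: sset_range)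
  have "axis w g !! Suc i \<noteq> linv (axis w g !! i)" for i
  proof (induction i rule: less_induct)
    case (less i)
    consider "Suc i < length w" | "Suc i = length w" | "i \<ge> length w" by linarith
    then show ?case
    proof cases
      case 1
      have "w ! Suc i \<noteq> linv (w ! i)"
        using cyc 1 successively_nth[of _ w i] by (auto simp: cyc_reduced_def reduced_def)
      then show ?thesis using 1 by (simp add: axis_snth_less del: snth.simps)
    next
      case 2
      have "axis w g !! Suc i = lact G g (hd w)"
        using 2 w(1) axis_snth_ge[of w "Suc i" g] axis_snth_less[of 0 w g]
        by (simp add: hd_conv_nth del: snth.simps)
      moreover have "axis w g !! i = last w"
        using 2 w(1) by (simp add: axis_snth_less last_conv_nth flip: 2)
      ultimately show ?thesis using cyc w(1) by (simp add: cyc_reduced_def)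
    next
      case 3
      let ?j = "i - length w"
      have "axis w g !! Suc ?j \<noteq> linv (axis w g !! ?j)" using 3 w(1) by (intro less.IH) (cases w; simp)
      moreover have "axis w g !! Suc i = lact G g (axis w g !! Suc ?j)"
        "axis w g !! i = lact G g (axis w g !! ?j)"
        using 3 w(1) by (simp_all add: axis_snth_ge Suc_diff_le del: snth.simps)
      ultimately show ?thesis
        using G.lact_eq_linv[OF letters_subset letters_subset g, OF in_letters in_letters] by metis
    qed
  qed
  then show "sreduced (axis w g)" by (simp only: sreduced_def) simp
qed

lemma axis_fixed:
  assumes w: "w \<noteq> []" "set w \<subseteq> letters" and g: "g \<in> carrier G" and cyc: "cyc_reduced w g"
  shows "axis w g \<in> fixed_ends (word_elt w \<otimes> \<iota> g)"
proof -
  have e: "axis w g \<in> ends" using assms by (rule axis_ends)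
  have "act (word_elt w \<otimes> \<iota> g) (axis w g) = act (word_elt w) (smap (lact G g) (axis w g))"
    using w g e by (simp add: act_mult act_\<iota> ends_space)
  also have "\<dots> = w @- smap (lact G g) (axis w g)"
    using w(2) e ends_space axis_unfold[OF w(1), of g] by (intro act_word_elt) simp_all
  finally show ?thesis using e axis_unfold[OF w(1), of g] by (simp add: fixed_ends_def)
qed

text \<open>
  Without cancellation between \<open>w\<close> and \<open>g \<eta>\<close>, being fixed is the defining equation of the axis.
\<close>

lemma fixed_end_eq_axis:
  assumes w: "w \<noteq> []" "set w \<subseteq> letters" "reduced w" and g: "g \<in> carrier G"
    and \<eta>: "\<eta> \<in> fixed_ends (word_elt w \<otimes> \<iota> g)" and nc: "lact G g (shd \<eta>) \<noteq> linv (last w)"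
  shows "\<eta> = axis w g"
proof (rule axis_unique[OF w(1)])
  have e: "\<eta> \<in> ends" using \<eta> by (simp add: fixed_ends_def)
  have ge: "smap (lact G g) \<eta> \<in> stream_space G"
    using e g by (simp add: ends_space G.smap_lact_closed)
  have "w @- smap (lact G g) \<eta> \<in> stream_space G"
    using ge w letters_subset nc by (auto simp: stream_space_def sreduced_shift)
  then have "act (word_elt w \<otimes> \<iota> g) \<eta> = w @- smap (lact G g) \<eta>"
    using w g e by (simp add: act_mult act_\<iota> ends_space act_word_elt)
  then show "\<eta> = w @- smap (lact G g) \<eta>" using \<eta> by (simp add: fixed_ends_def)
qed

lemma fixed_ends_inv: "x \<in> carrier H \<Longrightarrow> fixed_ends (inv x) = fixed_ends x"
  unfolding fixed_ends_def using act_inv ends_space by (metis (lifting))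

lemma set_linv_rev: "set w \<subseteq> letters \<Longrightarrow> set (map linv (rev w)) \<subseteq> letters"
  by (simp add: image_subset_iff) blast

lemma word_elt_linv_rev: "set w \<subseteq> letters \<Longrightarrow> word_elt (map linv (rev w)) = inv (word_elt w)"
proof (induction w)
  case (Cons l w)
  have l: "l \<in> letters" and w: "set w \<subseteq> letters" using Cons.prems by simp_all
  have "word_elt (map linv (rev (l # w))) = word_elt (map linv (rev w)) \<otimes> word_elt [linv l]"
    using set_linv_rev[OF w] l by (simp only: rev.simps map_append list.map) (rule word_elt_append; simp)
  then show ?case using l w by (simp add: Cons.IH letter_elt_linv H.inv_mult_group)
qed simp

text \<open>
  The two ends are the attracting ends of \<open>x = w g\<close> and of \<open>x\<inverse>\<close>. For a fixed end \<open>\<eta>\<close> there is no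
  cancellation in \<open>x \<eta>\<close> or none in \<open>x\<inverse> \<eta>\<close>: cancellation in both would make the first letter of
  \<open>\<eta>\<close> equal to the first letter of \<open>w\<close> and to \<open>g\<inverse>\<close> applied to the inverse of the last letter of \<open>w\<close>;
  these differ as \<open>w g\<close> is cyclically reduced.
\<close>

lemma hyperbolic_fixed_ends:
  assumes w: "w \<noteq> []" "set w \<subseteq> letters" and g: "g \<in> carrier G" and cyc: "cyc_reduced w g"
  shows "\<exists>\<xi> \<eta>. \<xi> \<noteq> \<eta> \<and> fixed_ends (word_elt w \<otimes> \<iota> g) = {\<xi>, \<eta>}"
proof -
  \<comment> \<open>the inverse of \<open>w g\<close> has the normal form \<open>v g'\<close>\<close>
  define g' where "g' = inv\<^bsub>G\<^esub> g"
  define v where "v = map (lact G g') (map linv (rev w))"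
  have g': "g' \<in> carrier G" using g by (simp add: g'_def)
  have red: "reduced w" and nc: "lact G g (hd w) \<noteq> linv (last w)"
    using cyc w(1) by (simp_all add: cyc_reduced_def)
  have hd_w: "hd w \<in> letters" and last_w: "last w \<in> letters" using w by auto
  have move: "lact G g l = m \<longleftrightarrow> l = lact G g' m" if "l \<in> letters" "m \<in> letters" for l m
    using G.lact_inv[OF letters_subset g, OF that(1)] G.lact_inv[OF letters_subset g, OF that(2)]
    by (auto simp: g'_def)
  have lv: "set (map linv (rev w)) \<subseteq> letters" using set_linv_rev[OF w(2)] .
  have v: "v \<noteq> []" "set v \<subseteq> letters"
    using w(1) set_map_lact[OF g' lv] by (simp_all add: v_def)
  have hd_v: "hd v = lact G g' (linv (last w))" and last_v: "last v = lact G g' (linv (hd w))"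
    using w(1) by (simp_all add: v_def hd_map last_map hd_rev last_rev)
  have word_elt_inv: "word_elt (map linv (rev w)) = inv (word_elt w)"
    using w(2) by (rule word_elt_linv_rev)
  have inv_eq: "inv (word_elt w \<otimes> \<iota> g) = word_elt v \<otimes> \<iota> g'"
  proof -
    have "inv (word_elt w \<otimes> \<iota> g) = \<iota> g' \<otimes> word_elt (map linv (rev w))"
      using w(2) g by (simp add: H.inv_mult_group word_elt_inv g'_def)
    then show ?thesis using word_elt_lact[OF g' lv] by (simp add: v_def)
  qed
  have red_v: "reduced v"
  proof -
    have "successively (\<lambda>l m. linv l \<noteq> m) w"
      using red unfolding reduced_def by (rule successively_mono) auto
    then have "successively (\<lambda>l m. lact G g' (linv l) \<noteq> lact G g' m) w"
    proof (rule successively_mono)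
      fix l m assume "l \<in> set w" "m \<in> set w" "linv l \<noteq> m"
      then show "lact G g' (linv l) \<noteq> lact G g' m"
        using G.lact_inj[OF letters_subset letters_subset g', of "linv l" m] w(2) by auto
    qed
    then show ?thesis
      unfolding reduced_def v_def successively_map successively_rev
      by (rule successively_mono) (metis lact_linv linv_simps(3))
  qed
  have cyc_v: "cyc_reduced v g'"
  proof -
    have "lact G g' (lact G g' (linv (last w))) \<noteq> lact G g' (hd w)"
      using nc move[OF hd_w, of "linv (last w)"] last_w hd_w g'
        G.lact_inj[OF letters_subset letters_subset g', of "lact G g' (linv (last w))" "hd w"]
      by (auto simp: lact_letters)
    then show ?thesis using red_v by (simp add: cyc_reduced_def hd_v last_v)
  qed
  have ax_v: "axis v g' \<in> fixed_ends (word_elt w \<otimes> \<iota> g)"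
    using axis_fixed[OF v g' cyc_v] fixed_ends_inv[of "word_elt w \<otimes> \<iota> g"] w(2) g by (simp add: inv_eq)
  have "\<eta> = axis w g \<or> \<eta> = axis v g'" if \<eta>: "\<eta> \<in> fixed_ends (word_elt w \<otimes> \<iota> g)" for \<eta>
  proof (cases "lact G g (shd \<eta>) = linv (last w)")
    case False
    then show ?thesis using fixed_end_eq_axis[OF w red g \<eta>] by blast
  next
    case True
    have "\<eta> \<in> ends" using \<eta> by (simp add: fixed_ends_def)
    then have sl: "shd \<eta> \<in> letters" using shd_sset[of \<eta>] endsD(2) by blast
    have "shd \<eta> \<noteq> hd w" using True nc by auto
    then have "lact G g' (shd \<eta>) \<noteq> linv (last v)"
      using G.lact_inj[OF letters_subset letters_subset g', OF sl hd_w] by (simp add: last_v)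
    moreover have "\<eta> \<in> fixed_ends (word_elt v \<otimes> \<iota> g')"
      using \<eta> fixed_ends_inv[of "word_elt w \<otimes> \<iota> g"] w(2) g by (simp add: inv_eq)
    ultimately show ?thesis using fixed_end_eq_axis[OF v red_v g'] by blast
  qed
  moreover have "axis w g \<noteq> axis v g'"
  proof
    assume "axis w g = axis v g'"
    then have "hd w = lact G g' (linv (last w))"
      using shd_axis[OF w(1)] shd_axis[OF v(1)] hd_v by metis
    then show False using nc move[OF hd_w, of "linv (last w)"] last_w by simp
  qed
  ultimately show ?thesis using axis_fixed[OF w g cyc] ax_v
    by (intro exI[of _ "axis w g"] exI[of _ "axis v g'"]) auto
qed

text \<open>
  All letters of a fixed end are fixed by \<open>g\<close>, and \<open>x\<close> is the only coset fixed by \<open>g\<close>.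
\<close>

lemma elliptic_fixed_ends:
  assumes g: "g \<in> carrier G" "g \<noteq> \<one>\<^bsub>G\<^esub>" and x: "x \<in> points" "g <#\<^bsub>G\<^esub> x = x"
  shows "fixed_ends (\<iota> g) = {sconst (x, True), sconst (x, False)}"
proof -
  have "sconst (x, e) \<in> fixed_ends (\<iota> g)" for e
  proof -
    have "sconst (x, e) \<in> ends" using x(1) by (intro endsI) (auto simp: sreduced_sconst letters_def)
    then show ?thesis using g(1) x(2)
      by (simp add: fixed_ends_def act_\<iota> ends_space smap_sconst lact_def)
  qed
  moreover have "\<xi> = sconst (x, True) \<or> \<xi> = sconst (x, False)" if "\<xi> \<in> fixed_ends (\<iota> g)" for \<xi>
  proof -
    have e: "\<xi> \<in> ends" and fixed: "smap (lact G g) \<xi> = \<xi>"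
      using that g(1) by (auto simp: fixed_ends_def act_\<iota> ends_space)
    have "fst (\<xi> !! i) = x" for i
    proof -
      have "\<xi> !! i \<in> letters" using endsD(2)[OF e] by auto
      moreover have "g <#\<^bsub>G\<^esub> fst (\<xi> !! i) = fst (\<xi> !! i)"
        using arg_cong[OF fixed, of "\<lambda>s. fst (s !! i)"] by (simp add: lact_def)
      ultimately show ?thesis using fixed_point_unique[OF g _ _ x, of "fst (\<xi> !! i)"]
        by (simp add: letters_def mem_Times_iff)
    qed
    then have "\<xi> = sconst (x, snd (shd \<xi>))" using sreduced_constant endsD(1)[OF e] by blast
    then show ?thesis by (cases "snd (shd \<xi>)") simp_all
  qed
  ultimately show ?thesis by blast
qed

lemma act_inj:
  assumes "x \<in> carrier H" "\<xi> \<in> stream_space G" "\<eta> \<in> stream_space G"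
  shows "act x \<xi> = act x \<eta> \<longleftrightarrow> \<xi> = \<eta>"
  using act_inv(1)[OF assms(1,2)] act_inv(1)[OF assms(1,3)] by metis

lemma act_conj_elt:
  assumes "x \<in> carrier H" "k \<in> carrier H" "\<xi> \<in> stream_space G"
  shows "act (conj_elt H x k) (act (inv k) \<xi>) = act (inv k) (act x \<xi>)"
  using assms by (simp add: conj_elt_def act_mult act_closed act_inv)

lemma hyperbolic_square:
  assumes w: "w \<noteq> []" "set w \<subseteq> letters" and g: "g \<in> carrier G" and cyc: "cyc_reduced w g"
  defines "v \<equiv> w @ map (lact G g) w"
  shows "v \<noteq> []" "set v \<subseteq> letters" "cyc_reduced v (g \<otimes>\<^bsub>G\<^esub> g)"
    "(word_elt w \<otimes> \<iota> g) \<otimes> (word_elt w \<otimes> \<iota> g) = word_elt v \<otimes> \<iota> (g \<otimes>\<^bsub>G\<^esub> g)"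
proof -
  have gw: "set (map (lact G g) w) \<subseteq> letters" using set_map_lact[OF g w(2)] .
  show "v \<noteq> []" "set v \<subseteq> letters" using w gw by (simp_all add: v_def)
  show "(word_elt w \<otimes> \<iota> g) \<otimes> (word_elt w \<otimes> \<iota> g) = word_elt v \<otimes> \<iota> (g \<otimes>\<^bsub>G\<^esub> g)"
    using normal_form_mult[OF w(2) w(2) g g] by (simp add: v_def)
  have red: "reduced w" and nc: "lact G g (hd w) \<noteq> linv (last w)"
    using cyc w(1) by (simp_all add: cyc_reduced_def)
  have hl: "hd w \<in> letters" "last w \<in> letters" using w by auto
  have "reduced (map (lact G g) w)"
    unfolding reduced_def successively_map
    using red[unfolded reduced_def]
  proof (rule successively_mono)
    fix l m assume "l \<in> set w" "m \<in> set w" "m \<noteq> linv l"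
    then show "lact G g m \<noteq> linv (lact G g l)"
      using G.lact_eq_linv[OF letters_subset letters_subset g, of m l] w(2) by auto
  qed
  then have "reduced v"
    using red nc w(1) by (simp add: v_def reduced_def successively_append_iff hd_map)
  moreover have "lact G (g \<otimes>\<^bsub>G\<^esub> g) (hd w) \<noteq> linv (lact G g (last w))"
    using G.lact_eq_linv[OF letters_subset letters_subset g, of "lact G g (hd w)" "last w"]
      nc hl g by (simp add: lact_letters G.lact_mult letters_subset)
  ultimately show "cyc_reduced v (g \<otimes>\<^bsub>G\<^esub> g)"
    using w(1) by (simp add: cyc_reduced_def v_def last_map)
qed

text \<open>
  Suppose that \<open>x\<close> interchanges \<open>\<xi>\<close> and \<open>\<eta>\<close>. If \<open>x\<close> is conjugate to \<open>g \<in> G\<close>, then \<open>g\<^sup>2\<close> fixes the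
  \<open>i\<close>-th letters of the two corresponding ends; as \<open>g\<^sup>2 \<noteq> 1\<close> unless \<open>g = 1\<close>, these letters carry
  the same coset, and also the same sign because \<open>g\<close> preserves signs. Otherwise \<open>x\<close> and \<open>x\<^sup>2\<close> each fix exactly
  two ends. So they fix the same ends, and \<open>\<xi>\<close>, which is fixed by \<open>x\<^sup>2\<close>, is fixed by \<open>x\<close>.
\<close>

lemma no_swap:
  assumes k: "k \<in> carrier H" and \<xi>: "\<xi> \<in> ends" and \<eta>: "\<eta> \<in> ends"
    and swap: "act k \<xi> = \<eta>" "act k \<eta> = \<xi>"
  shows "\<xi> = \<eta>"
proof -
  obtain z w g where z: "z \<in> carrier H" and w: "set w \<subseteq> letters" and g: "g \<in> carrier G"
    and cyc: "cyc_reduced w g" and conj: "conj_elt H k z = word_elt w \<otimes> \<iota> g"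
    using k by (rule cyc_reduced_conjugate)
  define x where "x = word_elt w \<otimes> \<iota> g"
  define \<xi>' where "\<xi>' = act (inv z) \<xi>"
  define \<eta>' where "\<eta>' = act (inv z) \<eta>"
  have x: "x \<in> carrier H" using w g by (simp add: x_def)
  have e: "\<xi>' \<in> ends" "\<eta>' \<in> ends" using z \<xi> \<eta> by (simp_all add: \<xi>'_def \<eta>'_def act_ends)
  have sw: "act x \<xi>' = \<eta>'" "act x \<eta>' = \<xi>'"
    using act_conj_elt[OF k z ends_space[OF \<xi>]] act_conj_elt[OF k z ends_space[OF \<eta>]] swap
    by (simp_all add: x_def \<xi>'_def \<eta>'_def conj)
  have "\<xi>' = \<eta>'"
  proof (cases "w = []")
    case True
    have sm: "smap (lact G g) \<xi>' = \<eta>'" "smap (lact G g) \<eta>' = \<xi>'"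
      using sw e g True by (simp_all add: x_def act_\<iota> ends_space)
    have "\<xi>' !! i = \<eta>' !! i" for i
    proof -
      have l: "\<xi>' !! i \<in> letters" "\<eta>' !! i \<in> letters"
        using endsD(2)[OF e(1)] endsD(2)[OF e(2)] snth_sset by blast+
      have s: "lact G g (\<xi>' !! i) = \<eta>' !! i" "lact G g (\<eta>' !! i) = \<xi>' !! i"
        using arg_cong[OF sm(1), of "\<lambda>s. s !! i"] arg_cong[OF sm(2), of "\<lambda>s. s !! i"] by simp_all
      show ?thesis
      proof (cases "g = \<one>\<^bsub>G\<^esub>")
        case True
        then show ?thesis using s(1) G.lact_one[OF letters_subset[OF l(1)]] by simp
      next
        case False
        then have "g \<otimes>\<^bsub>G\<^esub> g \<noteq> \<one>\<^bsub>G\<^esub>" using G_no_involution[OF g] by blast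
        moreover have "lact G (g \<otimes>\<^bsub>G\<^esub> g) (\<xi>' !! i) = \<xi>' !! i"
          "lact G (g \<otimes>\<^bsub>G\<^esub> g) (\<eta>' !! i) = \<eta>' !! i"
          using s g l letters_subset by (simp_all add: G.lact_mult)
        ultimately have "fst (\<xi>' !! i) = fst (\<eta>' !! i)"
          using l g by - (rule fixed_point_unique[of "g \<otimes>\<^bsub>G\<^esub> g"],
            simp_all add: letters_def lact_def prod_eq_iff mem_Times_iff)
        moreover have "snd (\<xi>' !! i) = snd (\<eta>' !! i)" using s(1) snd_lact by metis
        ultimately show ?thesis by (simp add: prod_eq_iff)
      qed
    qed
    then show ?thesis by (rule stream_eqI)
  next
    case False
    obtain a b where ab: "a \<noteq> b" "fixed_ends x = {a, b}"
      using hyperbolic_fixed_ends[OF False w g cyc] unfolding x_def by blast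
    obtain c d where cd: "c \<noteq> d" "fixed_ends (x \<otimes> x) = {c, d}"
      using hyperbolic_fixed_ends[OF hyperbolic_square(1,2)[OF False w g cyc] G.m_closed[OF g g]
        hyperbolic_square(3)[OF False w g cyc]]
      unfolding x_def hyperbolic_square(4)[OF False w g cyc] by blast
    have "fixed_ends x \<subseteq> fixed_ends (x \<otimes> x)"
      using x by (auto simp: fixed_ends_def act_mult ends_space)
    then have eq: "fixed_ends x = fixed_ends (x \<otimes> x)" using ab cd by auto
    have "\<xi>' \<in> fixed_ends (x \<otimes> x)"
      using x e sw by (simp add: fixed_ends_def act_mult ends_space)
    then have "\<xi>' \<in> fixed_ends x" by (simp only: eq)
    then show ?thesis using sw by (simp add: fixed_ends_def)
  qed
  then show ?thesis using act_inj[of "inv z" \<xi> \<eta>] z \<xi> \<eta> by (simp add: \<xi>'_def \<eta>'_def ends_space)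
qed

section \<open>Stabilizers of ends\<close>

text \<open>
  The element \<open>x\<close> carries the vertices of the ray \<open>\<xi>\<close>, from the \<open>m\<close>-th one on, to the vertices of \<open>\<eta>\<close>
  from the \<open>n\<close>-th one on, with a constant \<open>G\<close>-part \<open>g\<close>. If \<open>\<xi> = \<eta>\<close>, then \<open>n - m\<close> is the distance by which
  \<open>x\<close> translates towards \<open>\<xi>\<close>.
\<close>

definition tracks :: "'h \<Rightarrow> 'a letter stream \<Rightarrow> 'a letter stream \<Rightarrow> nat \<Rightarrow> nat \<Rightarrow> 'a \<Rightarrow> bool" where
  "tracks x \<xi> \<eta> m n g \<longleftrightarrow> (\<forall>i. x \<otimes> word_elt (stake (m + i) \<xi>) = word_elt (stake (n + i) \<eta>) \<otimes> \<iota> g)"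

lemma set_stake_letters: "\<xi> \<in> ends \<Longrightarrow> set (stake n \<xi>) \<subseteq> letters"
  using endsD(2)[of \<xi>] sset_shift[of "stake n \<xi>" "sdrop n \<xi>"] by (simp add: stake_sdrop)

lemma word_elt_stake_closed [simp]: "\<xi> \<in> ends \<Longrightarrow> word_elt (stake n \<xi>) \<in> carrier H"
  by (simp add: set_stake_letters)

lemma tracks_mult:
  assumes "x \<in> carrier H" "y \<in> carrier H" "g \<in> carrier G" "h \<in> carrier G"
    "\<xi> \<in> ends" "\<eta> \<in> ends" "\<zeta> \<in> ends"
    and x: "tracks x \<xi> \<eta> m n g" and y: "tracks y \<eta> \<zeta> m' n' h"
  shows "tracks (y \<otimes> x) \<xi> \<zeta> (m + m') (n' + n) (h \<otimes>\<^bsub>G\<^esub> g)"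
  unfolding tracks_def
proof
  fix i
  have "(y \<otimes> x) \<otimes> word_elt (stake (m + m' + i) \<xi>) = y \<otimes> (x \<otimes> word_elt (stake (m + (m' + i)) \<xi>))"
    using assms(1-7) by (simp add: H.m_assoc add.assoc)
  also have "\<dots> = y \<otimes> (word_elt (stake (m' + (n + i)) \<eta>) \<otimes> \<iota> g)"
    using x unfolding tracks_def by (simp add: add.left_commute)
  also have "\<dots> = (y \<otimes> word_elt (stake (m' + (n + i)) \<eta>)) \<otimes> \<iota> g"
    using assms(1-7) by (simp add: H.m_assoc)
  also have "\<dots> = word_elt (stake (n' + n + i) \<zeta>) \<otimes> \<iota> (h \<otimes>\<^bsub>G\<^esub> g)"
    using y assms(1-7) unfolding tracks_def by (simp add: H.m_assoc add.assoc)
  finally show "(y \<otimes> x) \<otimes> word_elt (stake (m + m' + i) \<xi>) = word_elt (stake (n' + n + i) \<zeta>) \<otimes> \<iota> (h \<otimes>\<^bsub>G\<^esub> g)" .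
qed

lemma tracks_inv:
  assumes "x \<in> carrier H" "g \<in> carrier G" "\<xi> \<in> ends" "\<eta> \<in> ends" "tracks x \<xi> \<eta> m n g"
  shows "tracks (inv x) \<eta> \<xi> n m (inv\<^bsub>G\<^esub> g)"
  unfolding tracks_def
proof
  fix i
  have "word_elt (stake (n + i) \<eta>) = (x \<otimes> word_elt (stake (m + i) \<xi>)) \<otimes> inv (\<iota> g)"
    using assms unfolding tracks_def by (simp add: H.m_assoc)
  then show "inv x \<otimes> word_elt (stake (n + i) \<eta>) = word_elt (stake (m + i) \<xi>) \<otimes> \<iota> (inv\<^bsub>G\<^esub> g)"
    using assms(1-4) by (simp add: H.m_assoc)
qed

lemma tracks_letter_elt:
  assumes "l \<in> letters" "\<xi> \<in> ends"
  shows "\<exists>m n. tracks (letter_elt l) \<xi> (push l \<xi>) m n \<one>\<^bsub>G\<^esub>"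
proof (cases "shd \<xi> = linv l")
  case True
  have "set (stake n (stl \<xi>)) \<subseteq> letters" for n
    using push_ends[OF assms] True set_stake_letters by (simp add: push_def)
  then have "tracks (letter_elt l) \<xi> (push l \<xi>) 1 0 \<one>\<^bsub>G\<^esub>"
    using assms True by (simp add: tracks_def push_def letter_elt_linv)
  then show ?thesis by blast
next
  case False
  then have "tracks (letter_elt l) \<xi> (push l \<xi>) 0 1 \<one>\<^bsub>G\<^esub>"
    using assms by (simp add: tracks_def push_def)
  then show ?thesis by blast
qed

text \<open>
  A single letter lengthens or shortens a ray at its beginning only, and \<open>G\<close> acts letterwise.
\<close>

lemma tracks_exists:
  assumes x: "x \<in> carrier H" and \<xi>: "\<xi> \<in> ends"
  obtains m n g where "g \<in> carrier G" "tracks x \<xi> (act x \<xi>) m n g"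
proof -
  obtain w g where w: "set w \<subseteq> letters" and g: "g \<in> carrier G" and x_eq: "x = word_elt w \<otimes> \<iota> g"
    using x by (rule normal_formE)
  have "\<exists>m n. tracks (word_elt w \<otimes> \<iota> g) \<xi> (act (word_elt w \<otimes> \<iota> g) \<xi>) m n g"
    using w
  proof (induction w)
    case Nil
    have "tracks (\<iota> g) \<xi> (act (\<iota> g) \<xi>) 0 0 g"
      using g \<xi> by (simp add: tracks_def act_\<iota> ends_space word_elt_lact set_stake_letters)
    then show ?case using g by auto
  next
    case (Cons l w)
    have l: "l \<in> letters" and w: "set w \<subseteq> letters" using Cons.prems by simp_all
    let ?y = "word_elt w \<otimes> \<iota> g"
    have y: "?y \<in> carrier H" using w g by simp
    have ye: "act ?y \<xi> \<in> ends" using y \<xi> by (rule act_ends)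
    have eq: "word_elt (l # w) \<otimes> \<iota> g = letter_elt l \<otimes> ?y" using l w g by (simp add: H.m_assoc)
    have le: "act (letter_elt l \<otimes> ?y) \<xi> = push l (act ?y \<xi>)"
      using l y \<xi> ye by (simp only: act_mult letter_elt_closed ends_space act_letter_elt)
    obtain m n where "tracks ?y \<xi> (act ?y \<xi>) m n g" using Cons.IH w by blast
    moreover obtain m' n' where "tracks (letter_elt l) (act ?y \<xi>) (push l (act ?y \<xi>)) m' n' \<one>\<^bsub>G\<^esub>"
      using tracks_letter_elt[OF l ye] by blast
    ultimately have "tracks (letter_elt l \<otimes> ?y) \<xi> (push l (act ?y \<xi>)) (m + m') (n' + n) (\<one>\<^bsub>G\<^esub> \<otimes>\<^bsub>G\<^esub> g)"
      using l g \<xi> y ye by (intro tracks_mult) (simp_all add: push_ends)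
    then show ?case using g unfolding eq le by auto
  qed
  then show thesis using that[OF g] x_eq by blast
qed

text \<open>
  The prefixes of this end are powers of \<open>u\<close> or of \<open>u\<inverse>\<close>, so tracking the end gives the form of \<open>x\<close>.
  The \<open>G\<close>-part fixes the end, hence the coset \<open>A\<close>, hence lies in \<open>A\<close>.
\<close>

lemma stabilizer_of_standard_end:
  assumes x: "x \<in> carrier H" and fixed: "act x (sconst (A, e)) = sconst (A, e)"
  obtains m n a where "a \<in> A" "x = u_pm e [^] (n::nat) \<otimes> \<iota> a \<otimes> inv (u_pm e [^] (m::nat))"
proof -
  define \<omega> where "\<omega> = sconst (A, e)"
  have \<omega>: "\<omega> \<in> ends" unfolding \<omega>_def
    using A_in_points by (intro endsI) (auto simp: sreduced_sconst letters_def)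
  have \<omega>_sel: "shd \<omega> = (A, e)" "stl \<omega> = \<omega>" by (simp_all add: \<omega>_def)
  have stake: "word_elt (stake n \<omega>) = u_pm e [^] n" for n
  proof (induction n)
    case (Suc n)
    then show ?case using H.nat_pow_Suc2[of "u_pm e" n] by (simp add: \<omega>_sel)
  qed simp
  have fix_pow: "act (u_pm e [^] n) \<omega> = \<omega>" for n :: nat
  proof (induction n)
    case (Suc n)
    have "push (A, e) \<omega> = \<omega>"
      using stream.collapse[of \<omega>] by (simp add: push_def \<omega>_sel)
    then show ?case using Suc \<omega> by (simp add: act_mult act_u_pm ends_space)
  qed (simp add: \<omega> ends_space)
  obtain m n g where g: "g \<in> carrier G" and "tracks x \<omega> (act x \<omega>) m n g"
    using x \<omega> by (rule tracks_exists)
  then have eq: "x \<otimes> u_pm e [^] m = u_pm e [^] n \<otimes> \<iota> g"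
    unfolding tracks_def fixed[folded \<omega>_def] using stake by (metis add.right_neutral)
  have "x = (x \<otimes> u_pm e [^] m) \<otimes> inv (u_pm e [^] m)" using x by (simp add: H.m_assoc)
  then have x_eq: "x = u_pm e [^] n \<otimes> \<iota> g \<otimes> inv (u_pm e [^] m)" by (simp only: eq)
  have "\<iota> g = inv (u_pm e [^] n) \<otimes> (u_pm e [^] n \<otimes> \<iota> g)" using g by simp
  then have g_eq: "\<iota> g = inv (u_pm e [^] n) \<otimes> (x \<otimes> u_pm e [^] m)" by (simp only: eq)
  have "act (inv (u_pm e [^] n)) \<omega> = \<omega>"
    using act_inv(1)[of "u_pm e [^] n" \<omega>] fix_pow \<omega> by (simp add: ends_space)
  then have "act (\<iota> g) \<omega> = \<omega>"
    unfolding g_eq using x fixed[folded \<omega>_def] fix_pow \<omega> by (simp add: act_mult ends_space)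
  then have "smap (lact G g) \<omega> = \<omega>" using g \<omega> by (simp add: act_\<iota> ends_space)
  then have "shd (smap (lact G g) \<omega>) = shd \<omega>" by simp
  then have "g <#\<^bsub>G\<^esub> A = A" by (simp add: lact_def \<omega>_sel)
  then show thesis using that x_eq A_fix g by blast
qed

lemma commute_generated:
  assumes z: "z \<in> carrier H" "z \<otimes> u_pm e = u_pm e \<otimes> z" and a: "a \<in> A" "z \<otimes> \<iota> a = \<iota> a \<otimes> z"
  shows "z \<otimes> (u_pm e [^] (n::nat) \<otimes> \<iota> a \<otimes> inv (u_pm e [^] (m::nat)))
    = (u_pm e [^] n \<otimes> \<iota> a \<otimes> inv (u_pm e [^] m)) \<otimes> z"
proof -
  have ac: "a \<in> carrier G" using a A_subset by blast
  have pow: "z \<otimes> u_pm e [^] k = u_pm e [^] k \<otimes> z" for k :: nat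
    using z by (induction k) (simp_all add: H.commute_mult)
  show ?thesis using z a ac pow
    by (intro H.commute_mult H.commute_inv) simp_all
qed

lemma standard_stabilizer_abelian:
  assumes x: "x \<in> carrier H" "act x (sconst (A, e)) = sconst (A, e)"
    and y: "y \<in> carrier H" "act y (sconst (A, e)) = sconst (A, e)"
  shows "x \<otimes> y = y \<otimes> x"
proof -
  obtain m n a where a: "a \<in> A" and x_eq: "x = u_pm e [^] (n::nat) \<otimes> \<iota> a \<otimes> inv (u_pm e [^] (m::nat))"
    using x by (rule stabilizer_of_standard_end)
  obtain m' n' b where b: "b \<in> A" and y_eq: "y = u_pm e [^] (n'::nat) \<otimes> \<iota> b \<otimes> inv (u_pm e [^] (m'::nat))"
    using y by (rule stabilizer_of_standard_end)
  have bc: "b \<in> carrier G" and ac: "a \<in> carrier G" using a b A_subset by blast+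
  have "u_pm e \<otimes> x = x \<otimes> u_pm e"
    unfolding x_eq using a by (intro commute_generated) (simp_all add: u_pm_comm)
  moreover have "\<iota> b \<otimes> x = x \<otimes> \<iota> b"
    unfolding x_eq using a b bc ac A_comm[OF a b]
    by (intro commute_generated) (simp_all add: u_pm_comm flip: \<iota>.hom_mult)
  ultimately show ?thesis
    unfolding y_eq using b x(1) by (intro commute_generated) simp_all
qed

text \<open>
  Translation distances add up, so the commutator \<open>d\<close> of \<open>x\<close> and \<open>y\<close> has translation distance \<open>0\<close> and is
  conjugate to some \<open>c \<in> G\<close> by a prefix \<open>f\<close> of \<open>\<xi>\<close>. If \<open>c \<noteq> 1\<close>, the remaining tail of \<open>\<xi>\<close> is
  constant, since \<open>c\<close> fixes all its letters; conjugation by \<open>f\<close> and by a representative of the coset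
  in this tail turns \<open>\<xi>\<close> into a constant end with coset \<open>A\<close>.
\<close>

lemma stabilizer_abelian:
  assumes \<xi>: "\<xi> \<in> ends" and x: "x \<in> carrier H" "act x \<xi> = \<xi>" and y: "y \<in> carrier H" "act y \<xi> = \<xi>"
  shows "x \<otimes> y = y \<otimes> x"
proof -
  obtain m n g where g: "g \<in> carrier G" and tx: "tracks x \<xi> \<xi> m n g"
    using tracks_exists[OF x(1) \<xi>] x(2) by metis
  obtain m' n' h where h: "h \<in> carrier G" and ty: "tracks y \<xi> \<xi> m' n' h"
    using tracks_exists[OF y(1) \<xi>] y(2) by metis
  define d where "d = x \<otimes> (y \<otimes> (inv x \<otimes> inv y))"
  \<comment> \<open>the total of the starting points needed to track \<open>\<xi>\<close> along the four factors\<close>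
  define N where "N = n' + n + m' + m"
  define c where "c = g \<otimes>\<^bsub>G\<^esub> (h \<otimes>\<^bsub>G\<^esub> (inv\<^bsub>G\<^esub> g \<otimes>\<^bsub>G\<^esub> inv\<^bsub>G\<^esub> h))"
  have d: "d \<in> carrier H" and c: "c \<in> carrier G" using x y g h by (simp_all add: d_def c_def)
  note tix = tracks_inv[OF x(1) g \<xi> \<xi> tx] and tiy = tracks_inv[OF y(1) h \<xi> \<xi> ty]
  have t1: "tracks (inv x \<otimes> inv y) \<xi> \<xi> (n' + n) (m + m') (inv\<^bsub>G\<^esub> g \<otimes>\<^bsub>G\<^esub> inv\<^bsub>G\<^esub> h)"
    using tracks_mult[OF _ _ _ _ \<xi> \<xi> \<xi> tiy tix] x y g h by simp
  have t2: "tracks (y \<otimes> (inv x \<otimes> inv y)) \<xi> \<xi> (n' + n + m') (n' + (m + m'))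
      (h \<otimes>\<^bsub>G\<^esub> (inv\<^bsub>G\<^esub> g \<otimes>\<^bsub>G\<^esub> inv\<^bsub>G\<^esub> h))"
    using tracks_mult[OF _ _ _ _ \<xi> \<xi> \<xi> t1 ty] x y g h by simp
  have "tracks d \<xi> \<xi> N (n + (n' + (m + m'))) c"
    using tracks_mult[OF _ _ _ _ \<xi> \<xi> \<xi> t2 tx] x y g h by (simp add: d_def N_def c_def)
  then have td: "tracks d \<xi> \<xi> N N c" by (simp add: N_def ac_simps)
  define f where "f = word_elt (stake N \<xi>)"
  have f: "f \<in> carrier H" using \<xi> by (simp add: f_def)
  have "d \<otimes> f = f \<otimes> \<iota> c" using td unfolding tracks_def f_def by (metis add.right_neutral)
  then have conj_d: "conj_elt H d f = \<iota> c" using d c f by (simp add: conj_elt_def H.m_assoc)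
  have comm_iff: "x \<otimes> y = y \<otimes> x" if "d = \<one>"
  proof -
    have "d \<otimes> (y \<otimes> x) = x \<otimes> y"
      using x y by (simp add: d_def H.m_assoc)
    then show ?thesis using that x y by simp
  qed
  show ?thesis
  proof (cases "c = \<one>\<^bsub>G\<^esub>")
    case True
    then have "d = \<one>" using conj_d d f by simp
    then show ?thesis by (rule comm_iff)
  next
    case False
    define \<zeta> where "\<zeta> = sdrop N \<xi>"
    have split: "stake N \<xi> @- \<zeta> = \<xi>" by (simp add: \<zeta>_def stake_sdrop)
    then have sset_\<zeta>: "sset \<zeta> \<subseteq> letters" using endsD(2)[OF \<xi>] sset_shift by (metis Un_subset_iff)
    have red_\<zeta>: "sreduced \<zeta>" using endsD(1)[OF \<xi>] by (simp add: \<zeta>_def sreduced_sdrop)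
    have \<zeta>: "\<zeta> \<in> ends" using red_\<zeta> sset_\<zeta> by (rule endsI)
    have act_f: "act f \<zeta> = \<xi>"
      unfolding f_def using act_word_elt[OF set_stake_letters[OF \<xi>, of N], of \<zeta>] split \<xi>
      by (simp add: ends_space)
    then have inv_f: "act (inv f) \<xi> = \<zeta>" using act_inv(1)[OF f ends_space[OF \<zeta>]] by simp
    have "act d \<xi> = \<xi>"
      using act_inv(1)[OF x(1) ends_space[OF \<xi>]] act_inv(1)[OF y(1) ends_space[OF \<xi>]] x y \<xi>
      by (simp add: d_def act_mult act_closed ends_space)
    then have "act (\<iota> c) \<zeta> = \<zeta>"
      using act_conj_elt[OF d f ends_space[OF \<xi>]] inv_f by (simp add: conj_d)
    then have "\<zeta> \<in> fixed_ends (\<iota> c)" using \<zeta> by (simp add: fixed_ends_def)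
    moreover obtain p where p: "p \<in> points" "c <#\<^bsub>G\<^esub> p = p"
    proof -
      have "smap (lact G c) \<zeta> = \<zeta>" using \<open>act (\<iota> c) \<zeta> = \<zeta>\<close> c \<zeta> by (simp add: act_\<iota> ends_space)
      then have "lact G c (shd \<zeta>) = shd \<zeta>" by (metis stream.map_sel(1))
      moreover have "shd \<zeta> \<in> letters" using sset_\<zeta> shd_sset by blast
      ultimately show thesis using that[of "fst (shd \<zeta>)"]
        by (simp add: lact_def letters_def prod_eq_iff mem_Times_iff)
    qed
    ultimately obtain e where \<zeta>_eq: "\<zeta> = sconst (p, e)"
      using elliptic_fixed_ends[OF c False p] by blast
    obtain r where r: "r \<in> carrier G" "p = r <#\<^bsub>G\<^esub> A" using p(1) by (auto simp: points_def)
    let ?\<omega> = "sconst (A, e)"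
    have \<omega>: "?\<omega> \<in> ends" using A_in_points by (intro endsI) (auto simp: sreduced_sconst letters_def)
    define k where "k = f \<otimes> \<iota> r"
    have k: "k \<in> carrier H" using f r by (simp add: k_def)
    have act_k: "act k ?\<omega> = \<xi>"
      using f r \<omega> act_f \<zeta>_eq by (simp add: k_def act_mult act_\<iota> ends_space smap_sconst lact_def)
    then have inv_k: "act (inv k) \<xi> = ?\<omega>" using act_inv(1)[OF k ends_space[OF \<omega>]] by simp
    have "conj_elt H x k \<otimes> conj_elt H y k = conj_elt H y k \<otimes> conj_elt H x k"
      using act_conj_elt[OF x(1) k ends_space[OF \<xi>]] act_conj_elt[OF y(1) k ends_space[OF \<xi>]] x y k inv_k
      by (intro standard_stabilizer_abelian[of _ e]) simp_all
    then show ?thesis using H.commute_conj_elt_iff[OF x(1) y(1) k] by blast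
  qed
qed

section \<open>Nontrivial elements are tame\<close>

text \<open>
  Whatever commutes with \<open>h\<close> permutes its two fixed ends, and it fixes both since it cannot
  interchange them.
\<close>

lemma two_fixed_ends_imp_tame:
  assumes h: "h \<in> carrier H" and fix_h: "fixed_ends h = {\<xi>, \<eta>}" and ne: "\<xi> \<noteq> \<eta>"
  shows "tame H h"
proof -
  have e: "\<xi> \<in> ends" "\<eta> \<in> ends" and fixed: "act h \<xi> = \<xi>" "act h \<eta> = \<eta>"
    using fix_h by (auto simp: fixed_ends_def)
  have stab: "act k \<xi> = \<xi> \<and> act k \<eta> = \<eta>"
    if k: "k \<in> carrier H" and "act k \<xi> \<in> {\<xi>, \<eta>}" "act k \<eta> \<in> {\<xi>, \<eta>}" for k
  proof -
    have "act k \<xi> \<noteq> act k \<eta>" using act_inj[OF k] e ends_space ne by blast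
    moreover have "\<not> (act k \<xi> = \<eta> \<and> act k \<eta> = \<xi>)" using no_swap[OF k e] ne by blast
    ultimately show ?thesis using that by auto
  qed
  have cent: "act k \<xi> = \<xi> \<and> act k \<eta> = \<eta>" if k: "k \<in> carrier H" and comm: "h \<otimes> k = k \<otimes> h" for k
  proof (rule stab[OF k])
    have "act k \<zeta> \<in> {\<xi>, \<eta>}" if "\<zeta> \<in> ends" "act h \<zeta> = \<zeta>" for \<zeta>
    proof -
      have "act h (act k \<zeta>) = act k (act h \<zeta>)"
        using act_mult[OF h k ends_space[OF that(1)]] act_mult[OF k h ends_space[OF that(1)]] comm by simp
      then have "act k \<zeta> \<in> fixed_ends h" using that act_ends[OF k] by (simp add: fixed_ends_def)
      then show ?thesis using fix_h by simp
    qed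
    then show "act k \<xi> \<in> {\<xi>, \<eta>}" "act k \<eta> \<in> {\<xi>, \<eta>}" using e fixed by blast+
  qed
  show ?thesis
  proof (rule tameI)
    fix x y
    assume "x \<in> carrier H" "y \<in> carrier H" "h \<otimes> x = x \<otimes> h" "h \<otimes> y = y \<otimes> h"
    then show "x \<otimes> y = y \<otimes> x" using cent stabilizer_abelian[OF e(1)] by blast
  next
    fix g
    assume g: "g \<in> carrier H" and comm: "h \<otimes> conj_elt H h g = conj_elt H h g \<otimes> h"
    have f: "act (conj_elt H h g) \<xi> = \<xi>" "act (conj_elt H h g) \<eta> = \<eta>"
      using cent[OF _ comm] h g by simp_all
    have "act g \<zeta> \<in> {\<xi>, \<eta>}" if "\<zeta> \<in> ends" "act (conj_elt H h g) \<zeta> = \<zeta>" for \<zeta>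
    proof -
      have "g \<otimes> conj_elt H h g = h \<otimes> g" using h g by (simp add: conj_elt_def H.m_assoc)
      then have "act h (act g \<zeta>) = act g (act (conj_elt H h g) \<zeta>)"
        using act_mult[OF g _ ends_space[OF that(1)], of "conj_elt H h g"]
          act_mult[OF h g ends_space[OF that(1)]] h g by simp
      then have "act g \<zeta> \<in> fixed_ends h" using that act_ends[OF g] by (simp add: fixed_ends_def)
      then show ?thesis using fix_h by simp
    qed
    then have "act g \<xi> = \<xi>" using stab[OF g] e f by blast
    then show "h \<otimes> g = g \<otimes> h" using stabilizer_abelian[OF e(1) h fixed(1) g] by blast
  qed
qed

text \<open>
  Such a \<open>g\<close> fixes no vertex but the base vertex, whose stabilizer is \<open>G\<close>. Elements commuting with \<open>g\<close>, as
  well as elements \<open>k\<close> for which the conjugate of \<open>g\<close> by \<open>k\<close> lies in \<open>G\<close>, map the base vertex to a vertex fixed by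
  \<open>g\<close>, and therefore belong to \<open>G\<close>.
\<close>

lemma fixed_point_free_imp_tame:
  assumes g: "g \<in> carrier G" "g \<noteq> \<one>\<^bsub>G\<^esub>" and free: "\<And>x. x \<in> points \<Longrightarrow> g <#\<^bsub>G\<^esub> x \<noteq> x"
  shows "tame H (\<iota> g)"
proof -
  have in_G: "\<exists>c \<in> carrier G. k = \<iota> c"
    if k: "k \<in> carrier H" and fixed: "act (\<iota> g) (act k basepoint) = act k basepoint" for k
  proof -
    obtain w c where w: "set w \<subseteq> letters" "reduced w" and c: "c \<in> carrier G" and k_eq: "k = word_elt w \<otimes> \<iota> c"
      using k by (rule reduced_normal_formE)
    have kb: "act k basepoint = w @- basepoint"
      unfolding k_eq using w c by (rule act_normal_form_basepoint)
    have "w = []"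
    proof (rule ccontr)
      assume "w \<noteq> []"
      have "smap (lact G g) (w @- basepoint) = w @- basepoint"
        using fixed g(1) shift_basepoint_space[OF w] by (simp add: kb act_\<iota>)
      then have "shd (smap (lact G g) (w @- basepoint)) = shd (w @- basepoint)" by simp
      then have "lact G g (hd w) = hd w" using \<open>w \<noteq> []\<close> by (cases w) simp_all
      moreover have "hd w \<in> letters" using w(1) \<open>w \<noteq> []\<close> by auto
      ultimately show False
        using free[of "fst (hd w)"] by (simp add: lact_def letters_def prod_eq_iff mem_Times_iff)
    qed
    then show ?thesis using c k_eq by auto
  qed
  have cent: "\<exists>c \<in> carrier G. k = \<iota> c" if k: "k \<in> carrier H" and "\<iota> g \<otimes> k = k \<otimes> \<iota> g" for k
  proof (rule in_G[OF k])
    have "act (\<iota> g) (act k basepoint) = act k (act (\<iota> g) basepoint)"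
      using that g(1) act_mult[of "\<iota> g" k basepoint] act_mult[of k "\<iota> g" basepoint] basepoint_space
      by simp
    then show "act (\<iota> g) (act k basepoint) = act k basepoint" using g(1) by (simp add: act_\<iota>_basepoint)
  qed
  have comm_G: "\<iota> a \<otimes> \<iota> b = \<iota> b \<otimes> \<iota> a \<longleftrightarrow> a \<otimes>\<^bsub>G\<^esub> b = b \<otimes>\<^bsub>G\<^esub> a"
    if "a \<in> carrier G" "b \<in> carrier G" for a b
    using that by (metis \<iota>.hom_mult \<iota>_inj G.m_closed)
  note tame_g = G_tame[OF g]
  show ?thesis
  proof (rule tameI)
    fix x y
    assume *: "x \<in> carrier H" "y \<in> carrier H" "\<iota> g \<otimes> x = x \<otimes> \<iota> g" "\<iota> g \<otimes> y = y \<otimes> \<iota> g"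
    then obtain a b where "a \<in> carrier G" "x = \<iota> a" "b \<in> carrier G" "y = \<iota> b" using cent by metis
    then show "x \<otimes> y = y \<otimes> x" using * comm_G g(1) tame_commute[OF tame_g, of a b] by simp
  next
    fix k
    assume k: "k \<in> carrier H" and comm: "\<iota> g \<otimes> conj_elt H (\<iota> g) k = conj_elt H (\<iota> g) k \<otimes> \<iota> g"
    obtain c where c: "c \<in> carrier G" "conj_elt H (\<iota> g) k = \<iota> c" using cent[OF _ comm] k g(1) by auto
    have "k \<otimes> \<iota> c = \<iota> g \<otimes> k" unfolding c(2) [symmetric] using k g(1) by (simp add: conj_elt_def H.m_assoc)
    then have "act (\<iota> g) (act k basepoint) = act k (act (\<iota> c) basepoint)"
      using k c(1) g(1) act_mult[of "\<iota> g" k basepoint] act_mult[of k "\<iota> c" basepoint] basepoint_space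
      by simp
    then obtain b where b: "b \<in> carrier G" "k = \<iota> b" using in_G[OF k] c(1) by (auto simp: act_\<iota>_basepoint)
    have "conj_elt H (\<iota> g) k = \<iota> (conj_elt G g b)" using b g(1) by (simp add: conj_elt_def)
    then have "g \<otimes>\<^bsub>G\<^esub> b = b \<otimes>\<^bsub>G\<^esub> g"
      using comm comm_G g(1) b by (simp add: tame_conj_elt[OF tame_g])
    then show "\<iota> g \<otimes> k = k \<otimes> \<iota> g" using comm_G g(1) b by simp
  qed
qed

lemma nontrivial_imp_tame:
  assumes x: "x \<in> carrier H" "x \<noteq> \<one>"
  shows "tame H x"
proof -
  obtain k w g where k: "k \<in> carrier H" and w: "set w \<subseteq> letters" and g: "g \<in> carrier G"
    and cyc: "cyc_reduced w g" and conj: "conj_elt H x k = word_elt w \<otimes> \<iota> g"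
    using x(1) by (rule cyc_reduced_conjugate)
  have "tame H (word_elt w \<otimes> \<iota> g)"
  proof (cases "w = []")
    case False
    then show ?thesis
      using hyperbolic_fixed_ends[OF False w g cyc] two_fixed_ends_imp_tame w g by auto
  next
    case True
    have "conj_elt H x k \<noteq> \<one>" using x k by simp
    then have g1: "g \<noteq> \<one>\<^bsub>G\<^esub>" using conj True by auto
    have "tame H (\<iota> g)"
    proof (cases "\<exists>p \<in> points. g <#\<^bsub>G\<^esub> p = p")
      case True
      then obtain p where p: "p \<in> points" "g <#\<^bsub>G\<^esub> p = p" by blast
      have "shd (sconst (p, True)) \<noteq> shd (sconst (p, False))" by simp
      then have "sconst (p, True) \<noteq> sconst (p, False)" by metis
      then show ?thesis using elliptic_fixed_ends[OF g g1 p] g by (intro two_fixed_ends_imp_tame) auto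
    next
      case False
      then show ?thesis using fixed_point_free_imp_tame[OF g g1] by blast
    qed
    then show ?thesis using True g by simp
  qed
  then show ?thesis using H.tame_conj[OF x(1) k] conj by simp
qed

text \<open>
  The square of a cyclically reduced \<open>w g\<close> with nonempty \<open>w\<close> moves the base vertex. If \<open>w\<close> is empty, the
  element is conjugate into \<open>G\<close>.
\<close>

lemma no_involution:
  assumes x: "x \<in> carrier H" "x \<otimes> x = \<one>"
  shows "x = \<one>"
proof -
  obtain k w g where k: "k \<in> carrier H" and w: "set w \<subseteq> letters" and g: "g \<in> carrier G"
    and cyc: "cyc_reduced w g" and conj: "conj_elt H x k = word_elt w \<otimes> \<iota> g"
    using x(1) by (rule cyc_reduced_conjugate)
  have sq: "(word_elt w \<otimes> \<iota> g) \<otimes> (word_elt w \<otimes> \<iota> g) = \<one>"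
    using H.conj_elt_mult[OF x(1) x(1) k] x(2) k by (simp add: conj)
  have "w = []"
  proof (rule ccontr)
    assume ne: "w \<noteq> []"
    define v where "v = w @ map (lact G g) w"
    note v = hyperbolic_square[OF ne w g cyc, folded v_def]
    have "v @- basepoint = act \<one> basepoint"
      using act_normal_form_basepoint[of v "g \<otimes>\<^bsub>G\<^esub> g"] v g sq by (simp add: cyc_reduced_def)
    then have "v @- basepoint = [] @- basepoint" by (simp add: basepoint_space)
    then show False using shift_basepoint_inj[of v "[]"] v by simp
  qed
  then have "\<iota> (g \<otimes>\<^bsub>G\<^esub> g) = \<iota> \<one>\<^bsub>G\<^esub>" using sq g by simp
  then have "g \<otimes>\<^bsub>G\<^esub> g = \<one>\<^bsub>G\<^esub>" using g by (intro \<iota>_inj) simp_all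
  then have "g = \<one>\<^bsub>G\<^esub>" by (rule G_no_involution[OF g])
  then have "conj_elt H x k = \<one>" using conj \<open>w = []\<close> by simp
  then show ?thesis using x(1) k by simp
qed

theorem CSA_star: "CSA_star_group H"
  unfolding H.CSA_star_group_iff_tame
proof (intro conjI ballI impI)
  show "tame H x" if "x \<in> carrier H" "x \<noteq> \<one>" for x using that by (rule nontrivial_imp_tame)
  show "x = \<one>" if "x \<in> carrier H" "x \<otimes> x = \<one>" for x using that by (rule no_involution)
qed

end

section \<open>The HNN extension\<close>

lemma mult_BijGroup:
  "f \<in> Bij S \<Longrightarrow> g \<in> Bij S \<Longrightarrow> f \<otimes>\<^bsub>BijGroup S\<^esub> g = compose S f g"
  by (simp add: BijGroup_def)

lemma carrier_BijGroup: "carrier (BijGroup S) = Bij S"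
  by (simp add: BijGroup_def)

context group
begin

lemma smap_lact_hom: "(\<lambda>g. \<lambda>\<xi>\<in>stream_space G. smap (lact G g) \<xi>) \<in> hom G (BijGroup (stream_space G))"
proof (rule homI)
  let ?S = "stream_space G" and ?p = "\<lambda>g. \<lambda>\<xi>\<in>stream_space G. smap (lact G g) \<xi>"
  have Bij: "?p g \<in> Bij ?S" if g: "g \<in> carrier G" for g
  proof -
    have "bij_betw (smap (lact G g)) ?S ?S"
      using g by (intro bij_betw_byWitness[where f' = "smap (lact G (inv g))"])
        (auto simp: smap_lact_closed smap_lact_one simp flip: smap_lact_mult)
    then show ?thesis by (simp add: Bij_def bij_betw_cong[of ?S "?p g" "smap (lact G g)"])
  qed
  show "?p g \<in> carrier (BijGroup ?S)" if "g \<in> carrier G" for g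
    using Bij[OF that] by (simp add: carrier_BijGroup)
  show "?p (g \<otimes> h) = ?p g \<otimes>\<^bsub>BijGroup ?S\<^esub> ?p h" if "g \<in> carrier G" "h \<in> carrier G" for g h
    using that Bij
    by (auto simp: mult_BijGroup compose_def smap_lact_mult smap_lact_closed intro!: restrict_ext)
qed

lemma push_Bij:
  assumes "fst l \<subseteq> carrier G"
  shows "(\<lambda>\<xi>\<in>stream_space G. push l \<xi>) \<in> Bij (stream_space G)"
proof -
  have inv: "push (linv m) (push m \<xi>) = \<xi>" if "\<xi> \<in> stream_space G" for m \<xi>
    using that by (intro push_linv_push) (simp add: stream_space_def)
  have "bij_betw (push l) (stream_space G) (stream_space G)"
    using assms inv[of _ l] inv[of _ "linv l"]
    by (intro bij_betw_byWitness[where f' = "push (linv l)"]) (auto simp: push_closed)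
  then show ?thesis
    by (simp add: Bij_def bij_betw_cong[of "stream_space G" "\<lambda>\<xi>\<in>stream_space G. push l \<xi>" "push l"])
qed

end

lemma HNN_extension_generated:
  fixes G :: "('a, 'm) monoid_scheme" and A :: "'a set" and f :: "'a \<Rightarrow> 'a"
  assumes "group G" and s: "s \<in> carrier G"
  defines "\<iota> \<equiv> \<lambda>g. hnn_class G A f [Base g]"
  defines "u \<equiv> hnn_class G A f [Stable] \<otimes>\<^bsub>HNN_extension G A f\<^esub> inv\<^bsub>HNN_extension G A f\<^esub> \<iota> s"
  shows "carrier (HNN_extension G A f) \<subseteq> generate (HNN_extension G A f) (insert u (\<iota> ` carrier G))"
proof
  let ?H = "HNN_extension G A f" and ?c = "hnn_class G A f"
  let ?K = "generate ?H (insert u (\<iota> ` carrier G))"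
  interpret G: group G by fact
  interpret H: group ?H using assms(1) by (rule HNN_extension_group)
  interpret \<iota>: group_hom G ?H \<iota>
    unfolding \<iota>_def by unfold_locales (rule HNN_extension_base_hom)
  have t: "?c [Stable] \<in> carrier ?H" by (rule HNN_extension_stable_closed)
  have u: "u \<in> carrier ?H" using t s by (simp add: u_def)
  have K: "subgroup ?K ?H" using u by (intro H.generate_is_subgroup) auto
  have uK: "u \<in> ?K" and \<iota>K: "g \<in> carrier G \<Longrightarrow> \<iota> g \<in> ?K" for g
    by (auto intro: generate.incl)
  have "?c [Stable] = u \<otimes>\<^bsub>?H\<^esub> \<iota> s" using t s by (simp add: u_def H.m_assoc)
  then have tK: "?c [Stable] \<in> ?K" using subgroup.m_closed[OF K uK \<iota>K[OF s]] by simp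
  then have tiK: "?c [Stable_inv] \<in> ?K"
    using subgroup.m_inv_closed[OF K tK] HNN_extension_inv_stable[OF assms(1), of A f] by simp
  fix X assume "X \<in> carrier ?H"
  then obtain w where w: "w \<in> hnn_words G" "X = ?c w" by (auto simp: HNN_extension_def)
  have "?c w \<in> ?K" using w(1)
  proof (induction w)
    case Nil
    have "?c [] = \<one>\<^bsub>?H\<^esub>" by (simp add: HNN_extension_def)
    then show ?case using subgroup.one_closed[OF K] by simp
  next
    case (Cons l w)
    have l: "[l] \<in> hnn_words G" and w: "w \<in> hnn_words G"
      using hnn_words_ConsD[OF Cons.prems] by simp_all
    have "?c [l] \<in> ?K" using l tK tiK \<iota>K by (cases l) (auto simp: \<iota>_def)
    moreover have "?c (l # w) = ?c [l] \<otimes>\<^bsub>?H\<^esub> ?c w" using HNN_extension_mult[OF l w, of A f] by simp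
    ultimately show ?case using subgroup.m_closed[OF K] Cons.IH[OF w] by simp
  qed
  then show "X \<in> ?K" using w(2) by simp
qed

text \<open>
  The stable letter \<open>t = u s\<close> has to act by \<open>s\<close> followed by the push of the letter \<open>(A, True)\<close>. Elements of \<open>A\<close> fix
  this letter, so they commute with the push, and conjugation by \<open>t\<close> agrees on \<open>A\<close> with
  conjugation by \<open>s\<close>, as the universal property demands.
\<close>

lemma HNN_extension_acts_on_streams:
  fixes G :: "('a, 'm) monoid_scheme" and A :: "'a set" and f :: "'a \<Rightarrow> 'a"
  assumes "group G" and A: "subgroup A G" and s: "s \<in> carrier G"
    and f: "\<And>a. a \<in> A \<Longrightarrow> f a = conj_elt G a s"
  defines "H \<equiv> HNN_extension G A f" and "S \<equiv> stream_space G"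
  defines "\<iota> \<equiv> \<lambda>g. hnn_class G A f [Base g]"
  defines "u \<equiv> hnn_class G A f [Stable] \<otimes>\<^bsub>H\<^esub> inv\<^bsub>H\<^esub> \<iota> s"
  shows "\<exists>h \<in> hom H (BijGroup S).
    (\<forall>g \<in> carrier G. h (\<iota> g) = (\<lambda>\<xi>\<in>S. smap (lact G g) \<xi>)) \<and> h u = (\<lambda>\<xi>\<in>S. push (A, True) \<xi>)"
proof -
  define p where "p g = (\<lambda>\<xi>\<in>S. smap (lact G g) \<xi>)" for g
  define q where "q = (\<lambda>\<xi>\<in>S. push (A, True) \<xi>)"
  interpret G: group G by fact
  interpret H: group H unfolding H_def using assms(1) by (rule HNN_extension_group)
  interpret K: group "BijGroup S" by (rule group_BijGroup)
  have AG: "A \<subseteq> carrier G" using A by (rule subgroup.subset)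
  have p: "p \<in> hom G (BijGroup S)" unfolding p_def S_def by (rule G.smap_lact_hom)
  interpret p: group_hom G "BijGroup S" p by unfold_locales (rule p)
  have q: "q \<in> carrier (BijGroup S)"
    unfolding q_def S_def carrier_BijGroup using AG by (intro G.push_Bij) simp
  have fixA: "lact G a (A, True) = (A, True)" if "a \<in> A" for a
    using that G.coset_join3[OF _ A, of a] AG by (auto simp: lact_def)
  have pq: "p a \<otimes>\<^bsub>BijGroup S\<^esub> q = q \<otimes>\<^bsub>BijGroup S\<^esub> p a" if a: "a \<in> A" for a
  proof -
    have ac: "a \<in> carrier G" using a AG by blast
    have "p a \<in> Bij S" "q \<in> Bij S" using ac q p.hom_closed by (simp_all add: carrier_BijGroup [symmetric])
    then show ?thesis
      using ac AG by (auto simp: mult_BijGroup compose_def p_def q_def S_def G.smap_lact_push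
          G.smap_lact_closed G.push_closed fixA[OF a] intro!: restrict_ext)
  qed
  have "\<exists>h \<in> hom (HNN_extension G A f) (BijGroup S). (\<forall>g \<in> carrier G. h (hnn_class G A f [Base g]) = p g) \<and>
    h (hnn_class G A f [Stable]) = q \<otimes>\<^bsub>BijGroup S\<^esub> p s"
  proof (rule HNN_extension_universal)
    show "group G" by fact
    show "A \<subseteq> carrier G" by (rule AG)
    show "f ` A \<subseteq> carrier G" using f s AG by auto
    show "group (BijGroup S)" by (rule group_BijGroup)
    show "p \<in> hom G (BijGroup S)" by (rule p)
    show "q \<otimes>\<^bsub>BijGroup S\<^esub> p s \<in> carrier (BijGroup S)" using q s by simp
    fix a assume a: "a \<in> A"
    then have ac: "a \<in> carrier G" using AG by blast
    have "conj_elt (BijGroup S) (p a) (q \<otimes>\<^bsub>BijGroup S\<^esub> p s)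
        = conj_elt (BijGroup S) (conj_elt (BijGroup S) (p a) q) (p s)"
      using ac s q by (simp add: K.conj_elt_conj_elt)
    also have "conj_elt (BijGroup S) (p a) q = p a"
      using K.conj_elt_eq_self_iff[of "p a" q] ac q pq[OF a] by simp
    also have "conj_elt (BijGroup S) (p a) (p s) = p (f a)"
      using f[OF a] ac s by (simp add: conj_elt_def)
    finally show "conj_elt (BijGroup S) (p a) (q \<otimes>\<^bsub>BijGroup S\<^esub> p s) = p (f a)" .
  qed
  then obtain h where h: "h \<in> hom H (BijGroup S)" and h\<iota>: "\<And>g. g \<in> carrier G \<Longrightarrow> h (\<iota> g) = p g"
    and ht: "h (hnn_class G A f [Stable]) = q \<otimes>\<^bsub>BijGroup S\<^esub> p s"
    unfolding H_def \<iota>_def by blast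
  interpret h: group_hom H "BijGroup S" h by unfold_locales (rule h)
  have \<iota>s: "\<iota> s \<in> carrier H"
    unfolding \<iota>_def H_def using HNN_extension_base_hom s by (rule hom_in_carrier)
  have "h u = (q \<otimes>\<^bsub>BijGroup S\<^esub> p s) \<otimes>\<^bsub>BijGroup S\<^esub> inv\<^bsub>BijGroup S\<^esub> p s"
    unfolding u_def using \<iota>s HNN_extension_stable_closed[of G A f] by (simp add: h\<iota>[OF s] ht H_def [symmetric])
  also have "\<dots> = q" using q s by (simp add: K.m_assoc)
  finally show ?thesis using h h\<iota> unfolding p_def q_def by blast
qed

theorem proposition4:
  fixes G :: "('a, 'm) monoid_scheme" and A B :: "'a set" and \<phi> :: "'a \<Rightarrow> 'a"
  assumes "CSA_star_group G"
    and "maximal_abelian_subgroup A G"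
    and "subgroup B G"
    and "\<phi> \<in> iso (G\<lparr>carrier := A\<rparr>) (G\<lparr>carrier := B\<rparr>)"
    and "\<exists>s \<in> carrier G. B = conj_set G A s \<and> (\<forall>a \<in> A. \<phi> a = conj_elt G a s)"
  shows "CSA_star_group (HNN_extension G A \<phi>)"
proof -
  obtain s where s: "s \<in> carrier G" and \<phi>: "\<And>a. a \<in> A \<Longrightarrow> \<phi> a = conj_elt G a s"
    using assms(5) by blast
  let ?H = "HNN_extension G A \<phi>"
  define \<iota> where "\<iota> g = hnn_class G A \<phi> [Base g]" for g
  define u where "u = hnn_class G A \<phi> [Stable] \<otimes>\<^bsub>?H\<^esub> inv\<^bsub>?H\<^esub> \<iota> s"
  have csa: "CSA_group G" using assms(1) by (simp add: CSA_star_group_def)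
  then interpret G: group G by (simp add: CSA_group_def)
  interpret H: group ?H using G.is_group by (rule HNN_extension_group)
  have A: "subgroup A G" and A_comm: "\<And>a b. a \<in> A \<Longrightarrow> b \<in> A \<Longrightarrow> a \<otimes>\<^bsub>G\<^esub> b = b \<otimes>\<^bsub>G\<^esub> a"
    using assms(2) by (simp_all add: maximal_abelian_subgroup_def G.abelian_subgroup_iff)
  have A_mal: "malnormal A G" using csa assms(2) by (simp add: CSA_group_def)
  have \<iota>_hom: "\<iota> \<in> hom G ?H"
    using HNN_extension_base_hom[of G A \<phi>] by (simp add: \<iota>_def [abs_def])
  then interpret \<iota>: group_hom G ?H \<iota> by unfold_locales
  have t: "hnn_class G A \<phi> [Stable] \<in> carrier ?H" by (rule HNN_extension_stable_closed)
  have u: "u \<in> carrier ?H" using t s by (simp add: u_def)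
  have AG: "A \<subseteq> carrier G" using A by (rule subgroup.subset)
  have u_comm: "u \<otimes>\<^bsub>?H\<^esub> \<iota> a = \<iota> a \<otimes>\<^bsub>?H\<^esub> u" if a: "a \<in> A" for a
  proof -
    have ac: "a \<in> carrier G" using a AG by blast
    have "conj_elt ?H (\<iota> a) (hnn_class G A \<phi> [Stable]) = \<iota> (\<phi> a)"
      unfolding \<iota>_def using G.is_group AG a s \<phi> by (intro HNN_extension_stable_conj) auto
    also have "\<dots> = conj_elt ?H (\<iota> a) (\<iota> s)" using \<phi>[OF a] ac s by (simp add: conj_elt_def)
    finally have "conj_elt ?H (\<iota> a) u = conj_elt ?H (conj_elt ?H (\<iota> a) (\<iota> s)) (inv\<^bsub>?H\<^esub> \<iota> s)"
      unfolding u_def using t ac s by (simp add: H.conj_elt_conj_elt [symmetric])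
    then have "conj_elt ?H (\<iota> a) u = \<iota> a" using ac s by (simp add: conj_elt_def H.m_assoc)
    then show ?thesis using H.conj_elt_eq_self_iff[of "\<iota> a" u] ac u by simp
  qed
  obtain h where h: "h \<in> hom ?H (BijGroup (stream_space G))"
    and h\<iota>: "\<And>g. g \<in> carrier G \<Longrightarrow> h (\<iota> g) = (\<lambda>\<xi>\<in>stream_space G. smap (lact G g) \<xi>)"
    and hu: "h u = (\<lambda>\<xi>\<in>stream_space G. push (A, True) \<xi>)"
    using HNN_extension_acts_on_streams[OF G.is_group A s \<phi>] unfolding \<iota>_def u_def by blast
  have h_Bij: "h x \<in> Bij (stream_space G)" if "x \<in> carrier ?H" for x
    using hom_in_carrier[OF h that] by (simp add: carrier_BijGroup)
  have star: "(\<forall>g \<in> carrier G. g \<noteq> \<one>\<^bsub>G\<^esub> \<longrightarrow> tame G g) \<and>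
      (\<forall>g \<in> carrier G. g \<otimes>\<^bsub>G\<^esub> g = \<one>\<^bsub>G\<^esub> \<longrightarrow> g = \<one>\<^bsub>G\<^esub>)"
    using assms(1) by (simp only: G.CSA_star_group_iff_tame)
  interpret centralizer_extension G ?H A \<iota> u h
  proof (intro centralizer_extension.intro centralizer_extension_axioms.intro)
    show "group G" "group ?H" by (rule G.is_group, rule H.is_group)
    show "subgroup A G" "malnormal A G" by fact+
    show "\<iota> \<in> hom G ?H" "u \<in> carrier ?H" by fact+
    show "a \<otimes>\<^bsub>G\<^esub> b = b \<otimes>\<^bsub>G\<^esub> a" if "a \<in> A" "b \<in> A" for a b using A_comm that .
    show "tame G g" if "g \<in> carrier G" "g \<noteq> \<one>\<^bsub>G\<^esub>" for g using star that by blast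
    show "g = \<one>\<^bsub>G\<^esub>" if "g \<in> carrier G" "g \<otimes>\<^bsub>G\<^esub> g = \<one>\<^bsub>G\<^esub>" for g using star that by blast
    show "u \<otimes>\<^bsub>?H\<^esub> \<iota> a = \<iota> a \<otimes>\<^bsub>?H\<^esub> u" if "a \<in> A" for a using u_comm that .
    show "carrier ?H \<subseteq> generate ?H (insert u (\<iota> ` carrier G))"
      unfolding u_def \<iota>_def using HNN_extension_generated[OF G.is_group s] .
    show "h x \<xi> \<in> stream_space G" if "x \<in> carrier ?H" "\<xi> \<in> stream_space G" for x \<xi>
      using Bij_imp_funcset[OF h_Bij[OF that(1)]] that(2) by (rule funcset_mem)
    show "h (x \<otimes>\<^bsub>?H\<^esub> y) \<xi> = h x (h y \<xi>)"
      if "x \<in> carrier ?H" "y \<in> carrier ?H" "\<xi> \<in> stream_space G" for x y \<xi>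
      using hom_mult[OF h that(1,2)] that h_Bij by (simp add: mult_BijGroup compose_eq)
    show "h (\<iota> g) \<xi> = smap (lact G g) \<xi>" if "g \<in> carrier G" "\<xi> \<in> stream_space G" for g \<xi>
      using that by (simp add: h\<iota>)
    show "h u \<xi> = push (A, True) \<xi>" if "\<xi> \<in> stream_space G" for \<xi>
      using that by (simp add: hu)
  qed
  show ?thesis by (rule CSA_star)
qed

end
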